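(* Let $\theta$ be the Thue-Morse substitution on $\{0,1\}$ given by $\theta(0)=01$, $\theta(1)=10$. Up to renaming of symbols, there are exactly twelve injective primitive substitutions $\beta$ of constant length $2$ such that $(X_\beta,\sigma)$ is topologically conjugate to $(X_\theta,\sigma)$, namely: (1) $1\to 12,\ 2\to 21$; (2) $1\to 21,\ 2\to 12$; (3) $1\to 12,\ 2\to 31,\ 3\to 21$; (4) $1\to 21,\ 2\to 13,\ 3\to 12$; (5) $1\to 12,\ 2\to 31,\ 3\to 34,\ 4\to 13$; (6) $1\to 23,\ 2\to 14,\ 3\to 21,\ 4\to 12$; (7) $1\to 21,\ 2\to 13,\ 3\to 43,\ 4\to 31$; (8) $1\to 23,\ 2\to 13,\ 3\to 41,\ 4\to 31$; (9) $1\to 12,\ 2\to 31,\ 3\to 45,\ 4\to 35,\ 5\to 14$; (10) $1\to 21,\ 2\to 13,\ 3\to 45,\ 4\to 51,\ 5\to 43$; (11) $1\to 23,\ 2\to 14,\ 3\to 21,\ 4\to 56,\ 5\to 63,\ 6\to 54$; (12) $1\to 23,\ 2\to 13,\ 3\to 41,\ 4\to 56,\ 5\to 46,\ 6\to 25$.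
   Context: An alphabet is a finite set $A$ with at least two elements. A substitution on $A$ is a map $\alpha:A\to A^*$, extended to finite and infinite words by juxtaposition; it has constant length $L$ if $\alpha(a)\in A^L$ for every $a\in A$. It is injective if $\alpha(a)\ne\alpha(b)$ for distinct letters $a,b$. It is primitive if for some $n>0$ and every $a\in A$ the word $\alpha^n(a)$ contains every letter of $A$. The language $\mathcal{L}_\alpha\subseteq A^*$ is the set of all factors (words of consecutive letters) of words $\alpha^n(a)$, $a\in A$, $n\ge 1$. $X_\alpha\subseteq A^{\mathbb{Z}}$ is the set of bi-infinite sequences all of whose finite factors lie in $\mathcal{L}_\alpha$, and $\sigma$ is the left shift. Two systems are topologically conjugate if there is a homeomorphism between them commuting with $\sigma$. Substitutions differing only by a bijective renaming of the symbols of the alphabet are regarded as the same. *)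

theory Defs
  imports "HOL-Analysis.Analysis" "HOL-Library.Sublist"
begin

(* The alphabet is an explicit finite set, so that substitutions on alphabets of
   different sizes can be compared.  A substitution is a total function of which
   only the values on the alphabet are ever used. *)

definition substitution :: "'a set \<Rightarrow> ('a \<Rightarrow> 'a list) \<Rightarrow> bool" where
  "substitution A \<alpha> \<longleftrightarrow> finite A \<and> 2 \<le> card A \<and> (\<forall>a\<in>A. \<alpha> a \<in> lists A)"

definition constant_length :: "'a set \<Rightarrow> ('a \<Rightarrow> 'a list) \<Rightarrow> nat \<Rightarrow> bool" where
  "constant_length A \<alpha> L \<longleftrightarrow> (\<forall>a\<in>A. length (\<alpha> a) = L)"

definition subst_word :: "('a \<Rightarrow> 'a list) \<Rightarrow> 'a list \<Rightarrow> 'a list" where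
  "subst_word \<alpha> w = concat (map \<alpha> w)"

definition subst_pow :: "('a \<Rightarrow> 'a list) \<Rightarrow> nat \<Rightarrow> 'a \<Rightarrow> 'a list" where
  "subst_pow \<alpha> n a = (subst_word \<alpha> ^^ n) [a]"

definition primitive :: "'a set \<Rightarrow> ('a \<Rightarrow> 'a list) \<Rightarrow> bool" where
  "primitive A \<alpha> \<longleftrightarrow> (\<exists>n>0. \<forall>a\<in>A. A \<subseteq> set (subst_pow \<alpha> n a))"

(* The library's sublist relation is that of contiguous factors. *)
definition language :: "'a set \<Rightarrow> ('a \<Rightarrow> 'a list) \<Rightarrow> 'a list set" where
  "language A \<alpha> = {w. \<exists>a\<in>A. \<exists>n\<ge>1. sublist w (subst_pow \<alpha> n a)}"

definition seq_factor :: "(int \<Rightarrow> 'a) \<Rightarrow> int \<Rightarrow> nat \<Rightarrow> 'a list" where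
  "seq_factor x i n = map (\<lambda>k. x (i + int k)) [0..<n]"

definition subst_space :: "'a set \<Rightarrow> ('a \<Rightarrow> 'a list) \<Rightarrow> (int \<Rightarrow> 'a) set" where
  "subst_space A \<alpha> = {x. range x \<subseteq> A \<and> (\<forall>i n. seq_factor x i n \<in> language A \<alpha>)}"

definition left_shift :: "(int \<Rightarrow> 'a) \<Rightarrow> (int \<Rightarrow> 'a)" where
  "left_shift x = (\<lambda>i. x (i + 1))"

(* X with the topology induced by the product of discrete topologies on A. *)
definition shift_topology :: "'a set \<Rightarrow> (int \<Rightarrow> 'a) set \<Rightarrow> (int \<Rightarrow> 'a) topology" where
  "shift_topology A X =
     subtopology (product_topology (\<lambda>_. discrete_topology A) UNIV) X"

definition topologically_conjugate ::
    "'a set \<Rightarrow> (int \<Rightarrow> 'a) set \<Rightarrow> 'b set \<Rightarrow> (int \<Rightarrow> 'b) set \<Rightarrow> bool" where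
  "topologically_conjugate A X B Y \<longleftrightarrow>
     (\<exists>h. homeomorphic_map (shift_topology A X) (shift_topology B Y) h \<and>
          (\<forall>x\<in>X. h (left_shift x) = left_shift (h x)))"

definition same_up_to_renaming ::
    "'a set \<Rightarrow> ('a \<Rightarrow> 'a list) \<Rightarrow> 'b set \<Rightarrow> ('b \<Rightarrow> 'b list) \<Rightarrow> bool" where
  "same_up_to_renaming A \<alpha> B \<beta> \<longleftrightarrow>
     (\<exists>f. bij_betw f A B \<and> (\<forall>a\<in>A. \<beta> (f a) = map f (\<alpha> a)))"

definition thue_morse :: "nat \<Rightarrow> nat list" where
  "thue_morse a = (if a = 0 then [0, 1] else [1, 0])"

definition thue_morse_space :: "(int \<Rightarrow> nat) set" where
  "thue_morse_space = subst_space {0, 1} thue_morse"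

(* A table [w1, ..., wk] encodes the substitution 1 -> w1, ..., k -> wk on {1, ..., k}. *)

definition table_alphabet :: "nat list list \<Rightarrow> nat set" where
  "table_alphabet t = {1..length t}"

definition table_subst :: "nat list list \<Rightarrow> nat \<Rightarrow> nat list" where
  "table_subst t a = t ! (a - 1)"

definition twelve_tables :: "nat list list list" where
  "twelve_tables =
    [ [[1,2], [2,1]],
      [[2,1], [1,2]],
      [[1,2], [3,1], [2,1]],
      [[2,1], [1,3], [1,2]],
      [[1,2], [3,1], [3,4], [1,3]],
      [[2,3], [1,4], [2,1], [1,2]],
      [[2,1], [1,3], [4,3], [3,1]],
      [[2,3], [1,3], [4,1], [3,1]],
      [[1,2], [3,1], [4,5], [3,5], [1,4]],
      [[2,1], [1,3], [4,5], [5,1], [4,3]],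
      [[2,3], [1,4], [2,1], [5,6], [6,3], [5,4]],
      [[2,3], [1,3], [4,1], [5,6], [4,6], [2,5]] ]"

end

theory Submission
  imports Defs
begin

text \<open>A conjugacy from the Thue-Morse system onto the system of \<open>\<beta>\<close> is a sliding block code \<open>F\<close>.
  By minimality, \<open>F\<close> (possibly after a shift) maps substituted points to substituted points, so
  \<open>F \<circ> \<theta> = \<beta> \<circ> F'\<close> for another injective block code \<open>F'\<close>.  Passing from \<open>F\<close> to \<open>F'\<close> roughly halves
  the window, so after finitely many steps both codes read three letters.  Two labellings of the
  six Thue-Morse words of length three determine \<open>\<beta>\<close>, because \<open>\<beta>\<close> of an \<open>F'\<close>-label is a pair of
  \<open>F\<close>-labels.  Both codes have the same two-letter words, \<open>F\<close> is not invariant under complementation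
  and \<open>\<beta>\<close> has no letter \<open>a\<close> with image \<open>aa\<close>; a finite search shows that only the twelve tables
  remain.  Conversely, in each table \<open>\<beta>\<close> arises from a labelling with \<open>F' = F\<close> or with \<open>F'\<close> equal to
  \<open>F\<close> after complementation, which a letter-to-letter map inverts up to a shift.\<close>

section \<open>Two-sided words and sliding block codes\<close>

text \<open>Renormalisation need not return the code it starts from, so no fixed code is sought. One
  step between two narrow codes already ties \<beta> to finite data, and the search therefore runs
  over pairs of labellings. Minimality is what makes single points sufficient. The parity of a
  desubstitution comes from a pigeonhole argument at one point, and it serves the others because
  every factor occurs in every point. An injective code into the system of \<beta> already produces
  every word of its language, so renormalisation only has to carry injectivity along. In the
  converse direction the inverse laws are checked on one image point and spread to the whole system
  in the same way. The twelve tables are told apart by counts that a renaming of letters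
  preserves.\<close>

definition shift :: "int \<Rightarrow> (int \<Rightarrow> 'a) \<Rightarrow> int \<Rightarrow> 'a" where
  "shift k x = (\<lambda>i. x (i + k))"

definition bisubst :: "('a \<Rightarrow> 'a list) \<Rightarrow> (int \<Rightarrow> 'a) \<Rightarrow> int \<Rightarrow> 'a" where
  "bisubst \<beta> y = (\<lambda>i. \<beta> (y (i div 2)) ! nat (i mod 2))"

text \<open>The left end \<open>a\<close> of the window is kept apart from its width
  \<open>w\<close> because they change by different rules: shifting the image only changes
  \<open>a\<close>, and renormalisation replaces \<open>a\<close> by \<open>a div 2\<close>.\<close>

definition block :: "('a list \<Rightarrow> 'b) \<Rightarrow> int \<Rightarrow> nat \<Rightarrow> (int \<Rightarrow> 'a) \<Rightarrow> int \<Rightarrow> 'b" where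
  "block \<phi> a w x = (\<lambda>i. \<phi> (seq_factor x (i + a) w))"

lemma length_seq_factor [simp]: "length (seq_factor x i n) = n"
  by (simp add: seq_factor_def)

lemma nth_seq_factor [simp]: "j < n \<Longrightarrow> seq_factor x i n ! j = x (i + int j)"
  by (simp add: seq_factor_def)

lemma set_seq_factor: "set (seq_factor x i n) \<subseteq> range x"
  by (auto simp: seq_factor_def)

lemma seq_factor_shift: "seq_factor (shift k x) i n = seq_factor x (i + k) n"
  by (rule nth_equalityI) (auto simp: shift_def algebra_simps)

lemma shift_shift: "shift a (shift b x) = shift (a + b) x"
  by (simp add: shift_def algebra_simps)

lemma shift_0 [simp]: "shift 0 x = x"
  by (simp add: shift_def)

lemma take_drop_seq_factor:
  "m + l \<le> n \<Longrightarrow> take l (drop m (seq_factor x i n)) = seq_factor x (i + int m) l"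
  by (rule nth_equalityI) (auto simp: algebra_simps)

lemma sublist_iff_take_drop: "sublist xs ys \<longleftrightarrow> (\<exists>m. m + length xs \<le> length ys \<and> xs = take (length xs) (drop m ys))"
proof
  assume "sublist xs ys"
  then obtain ps ss where "ys = ps @ xs @ ss" by (auto simp: sublist_def)
  then show "\<exists>m. m + length xs \<le> length ys \<and> xs = take (length xs) (drop m ys)"
    by (intro exI[of _ "length ps"]) auto
next
  assume "\<exists>m. m + length xs \<le> length ys \<and> xs = take (length xs) (drop m ys)"
  then show "sublist xs ys"
    by (metis sublist_drop sublist_order.order.trans sublist_take)
qed

lemma sublist_take_drop: "sublist (take l (drop m xs)) xs"
  by (metis sublist_drop sublist_order.order.trans sublist_take)

lemma sublist_seq_factor:
  assumes "i \<le> j" "j + int m \<le> i + int n"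
  shows "sublist (seq_factor x j m) (seq_factor x i n)"
proof -
  have "take m (drop (nat (j - i)) (seq_factor x i n)) = seq_factor x j m"
    using assms by (subst take_drop_seq_factor) auto
  then show ?thesis by (metis sublist_take_drop)
qed

lemma block_shift: "block \<phi> a w (shift k x) = shift k (block \<phi> a w x)"
  by (auto simp: block_def shift_def seq_factor_shift[unfolded shift_def] algebra_simps)

lemma shift_block: "shift k (block \<phi> a w x) = block \<phi> (a + k) w x"
  by (auto simp: block_def shift_def algebra_simps)

lemma shift_bisubst: "shift (2 * k) (bisubst \<beta> y) = bisubst \<beta> (shift k y)"
  by (auto simp: shift_def bisubst_def add.commute)

lemma left_shift_eq: "left_shift x = shift 1 x"
  by (simp add: left_shift_def shift_def)

lemma subst_word_append: "subst_word \<beta> (u @ v) = subst_word \<beta> u @ subst_word \<beta> v"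
  by (simp add: subst_word_def)

lemma subst_word_Nil [simp]: "subst_word \<beta> [] = []"
  by (simp add: subst_word_def)

lemma subst_word_Cons: "subst_word \<beta> (a # v) = \<beta> a @ subst_word \<beta> v"
  by (simp add: subst_word_def)

lemma sublist_subst_word: "sublist u v \<Longrightarrow> sublist (subst_word \<beta> u) (subst_word \<beta> v)"
  by (auto simp: sublist_def subst_word_append) blast

lemma funpow_subst_word_append:
  "(subst_word \<beta> ^^ n) (u @ v) = (subst_word \<beta> ^^ n) u @ (subst_word \<beta> ^^ n) v"
  by (induction n arbitrary: u v) (auto simp: subst_word_append)

lemma subst_pow_Suc: "subst_pow \<beta> (Suc n) a = subst_word \<beta> (subst_pow \<beta> n a)"
  by (simp add: subst_pow_def)

lemma subst_pow_0 [simp]: "subst_pow \<beta> 0 a = [a]"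
  by (simp add: subst_pow_def)

lemma subst_pow_add: "subst_pow \<beta> (m + n) a = (subst_word \<beta> ^^ m) (subst_pow \<beta> n a)"
  by (simp add: subst_pow_def funpow_add)

lemma sublist_subst_pow:
  assumes "b \<in> set (subst_pow \<beta> n a)"
  shows "sublist (subst_pow \<beta> m b) (subst_pow \<beta> (m + n) a)"
proof -
  obtain u v where "subst_pow \<beta> n a = u @ [b] @ v"
    using assms by (metis append_Cons append_Nil in_set_conv_decomp)
  then have "subst_pow \<beta> (m + n) a = (subst_word \<beta> ^^ m) u @ subst_pow \<beta> m b @ (subst_word \<beta> ^^ m) v"
    unfolding subst_pow_add by (simp add: subst_pow_def flip: funpow_subst_word_append)
  then show ?thesis by (auto simp: sublist_def)
qed

section \<open>Injective primitive substitutions of length two\<close>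

locale doubling =
  fixes A :: "'a set" and \<beta> :: "'a \<Rightarrow> 'a list"
  assumes substitution: "substitution A \<beta>"
    and constant_length: "constant_length A \<beta> 2"
    and inj: "inj_on \<beta> A"
    and primitive: "primitive A \<beta>"
begin

lemma length_image: "a \<in> A \<Longrightarrow> length (\<beta> a) = 2"
  using constant_length by (simp add: constant_length_def)

lemma set_image: "a \<in> A \<Longrightarrow> set (\<beta> a) \<subseteq> A"
  using substitution by (auto simp: substitution_def)

lemma image_eq: "a \<in> A \<Longrightarrow> \<beta> a = [\<beta> a ! 0, \<beta> a ! 1]"
  using length_image[of a] by (intro nth_equalityI) (auto simp: less_2_cases_iff)

lemma nth_image_in: "a \<in> A \<Longrightarrow> k < 2 \<Longrightarrow> \<beta> a ! k \<in> A"
  using length_image[of a] set_image[of a] nth_mem[of k "\<beta> a"] by auto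

lemma set_subst_word: "set w \<subseteq> A \<Longrightarrow> set (subst_word \<beta> w) \<subseteq> A"
  using set_image by (fastforce simp: subst_word_def)

lemma length_subst_word: "set w \<subseteq> A \<Longrightarrow> length (subst_word \<beta> w) = 2 * length w"
  by (induction w) (auto simp: subst_word_Cons length_image)

lemma nth_subst_word:
  "set w \<subseteq> A \<Longrightarrow> i < 2 * length w \<Longrightarrow> subst_word \<beta> w ! i = \<beta> (w ! (i div 2)) ! (i mod 2)"
proof (induction w arbitrary: i)
  case (Cons a w)
  show ?case
  proof (cases "i < 2")
    case True
    then show ?thesis using Cons.prems by (auto simp: subst_word_Cons nth_append length_image)
  next
    case False
    then have "i = Suc (Suc (i - 2))" by simp
    then obtain j where "i = Suc (Suc j)" by blast
    then show ?thesis using Cons by (auto simp: subst_word_Cons nth_append length_image)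
  qed
qed simp

lemma set_subst_pow: "a \<in> A \<Longrightarrow> set (subst_pow \<beta> n a) \<subseteq> A"
  by (induction n) (auto simp: subst_pow_Suc dest: set_subst_word)

lemma set_language: "w \<in> language A \<beta> \<Longrightarrow> set w \<subseteq> A"
  using set_subst_pow by (fastforce simp: language_def dest: set_mono_sublist)

lemma sublist_language: "w \<in> language A \<beta> \<Longrightarrow> sublist v w \<Longrightarrow> v \<in> language A \<beta>"
  by (auto simp: language_def intro: sublist_order.order.trans)

lemma subst_word_language:
  assumes "w \<in> language A \<beta>" shows "subst_word \<beta> w \<in> language A \<beta>"
proof -
  obtain a n where "a \<in> A" "sublist w (subst_pow \<beta> n a)"
    using assms by (auto simp: language_def)
  then have "a \<in> A" "sublist (subst_word \<beta> w) (subst_pow \<beta> (Suc n) a)"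
    by (auto simp: subst_pow_Suc intro: sublist_subst_word)
  then show ?thesis unfolding language_def by (metis (mono_tags, lifting) le_add1 mem_Collect_eq plus_1_eq_Suc)
qed

text \<open>The language is built from powers with exponent at least one, so a letter is not a word
  of it by definition; primitivity makes it occur in a positive power. This supplies the case of
  exponent one in \<open>language_desubstitution\<close>.\<close>

lemma singleton_language: "a \<in> A \<Longrightarrow> [a] \<in> language A \<beta>"
proof -
  assume a: "a \<in> A"
  obtain n where "n > 0" "\<forall>b\<in>A. A \<subseteq> set (subst_pow \<beta> n b)"
    using primitive by (auto simp: primitive_def)
  then have "n \<ge> 1" "a \<in> set (subst_pow \<beta> n a)" using a by auto
  then have "sublist [a] (subst_pow \<beta> n a)"
    by (metis append_Cons append_Nil in_set_conv_decomp sublist_def)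
  then show ?thesis using a \<open>n \<ge> 1\<close> by (auto simp: language_def)
qed

lemma language_desubstitution:
  assumes "w \<in> language A \<beta>"
  shows "\<exists>v\<in>language A \<beta>. sublist w (subst_word \<beta> v)"
proof -
  obtain a n where an: "a \<in> A" "n \<ge> 1" "sublist w (subst_pow \<beta> n a)"
    using assms by (auto simp: language_def)
  then obtain m where m: "n = Suc m" by (cases n) auto
  have "subst_pow \<beta> m a \<in> language A \<beta>"
  proof (cases m)
    case 0
    then show ?thesis using an singleton_language by simp
  next
    case (Suc k)
    then show ?thesis using an(1) unfolding language_def
      by (auto intro!: bexI[of _ a] exI[of _ m])
  qed
  then show ?thesis using an(3) unfolding m subst_pow_Suc by blast
qed

section \<open>Two-sided points: desubstitution and minimality\<close>

lemma range_subset: "x \<in> subst_space A \<beta> \<Longrightarrow> range x \<subseteq> A"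
  by (simp add: subst_space_def)

lemma value_in: "x \<in> subst_space A \<beta> \<Longrightarrow> x i \<in> A"
  using range_subset by blast

lemma factor_language: "x \<in> subst_space A \<beta> \<Longrightarrow> seq_factor x i n \<in> language A \<beta>"
  by (simp add: subst_space_def)

lemma subst_spaceI:
  assumes "\<And>i n. seq_factor x i n \<in> language A \<beta>"
  shows "x \<in> subst_space A \<beta>"
proof -
  have "x i \<in> A" for i
    using set_language[OF assms[of i 1]] by (simp add: seq_factor_def)
  then show ?thesis using assms by (auto simp: subst_space_def)
qed

text \<open>Integer division rounds down, so the phase \<open>i mod 2\<close> inside the image of
  \<open>y (i div 2)\<close> is right at negative positions too.\<close>

lemma seq_factor_bisubst:
  assumes "range y \<subseteq> A" "nat (i mod 2) + n \<le> 2 * m"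
  shows "seq_factor (bisubst \<beta> y) i n
    = take n (drop (nat (i mod 2)) (subst_word \<beta> (seq_factor y (i div 2) m)))"
proof (rule nth_equalityI)
  have s: "set (seq_factor y (i div 2) m) \<subseteq> A"
    using assms(1) set_seq_factor by fastforce
  show "length (seq_factor (bisubst \<beta> y) i n)
    = length (take n (drop (nat (i mod 2)) (subst_word \<beta> (seq_factor y (i div 2) m))))"
    using assms(2) length_subst_word[OF s] by auto
  fix j assume "j < length (seq_factor (bisubst \<beta> y) i n)"
  then have j: "j < n" by simp
  define k where "k = nat (i mod 2) + j"
  have ik: "i + int j = 2 * (i div 2) + int k" unfolding k_def by simp
  have k: "k < 2 * m" using assms j by (simp add: k_def)
  have d: "(i + int j) div 2 = i div 2 + int (k div 2)" "nat ((i + int j) mod 2) = k mod 2"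
    unfolding ik by (simp_all add: zdiv_int nat_mod_as_int mod_mult_self4 add.commute)
  have "take n (drop (nat (i mod 2)) (subst_word \<beta> (seq_factor y (i div 2) m))) ! j
    = subst_word \<beta> (seq_factor y (i div 2) m) ! k"
    using j k length_subst_word[OF s] by (simp add: k_def)
  also have "\<dots> = \<beta> (seq_factor y (i div 2) m ! (k div 2)) ! (k mod 2)"
    using k by (intro nth_subst_word[OF s]) auto
  also have "\<dots> = \<beta> (y (i div 2 + int (k div 2))) ! (k mod 2)"
    using k by (subst nth_seq_factor) auto
  finally show "seq_factor (bisubst \<beta> y) i n ! j
    = take n (drop (nat (i mod 2)) (subst_word \<beta> (seq_factor y (i div 2) m))) ! j"
    using j by (simp add: bisubst_def d)
qed

lemma sublist_seq_factor_bisubst: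
  assumes "range y \<subseteq> A"
  shows "sublist (seq_factor (bisubst \<beta> y) i n) (subst_word \<beta> (seq_factor y (i div 2) (n div 2 + 1)))"
proof -
  have "i mod 2 \<in> {0, 1}" by auto
  then have "nat (i mod 2) + n \<le> 2 * (n div 2 + 1)" by auto
  then show ?thesis using seq_factor_bisubst[OF assms] sublist_take_drop by metis
qed

lemma bisubst_in_space: "y \<in> subst_space A \<beta> \<Longrightarrow> bisubst \<beta> y \<in> subst_space A \<beta>"
  by (intro subst_spaceI)
    (metis sublist_seq_factor_bisubst factor_language range_subset sublist_language subst_word_language)

lemma shift_in_space: "y \<in> subst_space A \<beta> \<Longrightarrow> shift k y \<in> subst_space A \<beta>"
  by (intro subst_spaceI) (simp add: seq_factor_shift factor_language)

lemma bisubst_inj: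
  assumes "range y \<subseteq> A" "range z \<subseteq> A" "bisubst \<beta> y = bisubst \<beta> z"
  shows "y = z"
proof
  fix i
  have "bisubst \<beta> y (2 * i) = bisubst \<beta> z (2 * i)" "bisubst \<beta> y (2 * i + 1) = bisubst \<beta> z (2 * i + 1)"
    using assms(3) by auto
  then have "\<beta> (y i) ! 0 = \<beta> (z i) ! 0" "\<beta> (y i) ! 1 = \<beta> (z i) ! 1"
    by (auto simp: bisubst_def)
  then have "\<beta> (y i) = \<beta> (z i)" 
    using image_eq[of "y i"] image_eq[of "z i"] assms by (metis rangeI subsetD)
  then show "y i = z i" using assms inj by (meson inj_onD rangeI subsetD)
qed

text \<open>A factor of length n > 2 lies inside the image of a factor of length n div 2 + 1 < n of
  another member of \<open>Z\<close>. Lengths therefore descend until they reach two, where this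
  bound stops decreasing; that is why exactly the two-letter factors have to be checked by
  hand.\<close>

lemma space_if_self_desubstituting:
  assumes Z: "\<And>z. z \<in> Z \<Longrightarrow> range z \<subseteq> A"
    and desub: "\<And>z. z \<in> Z \<Longrightarrow> \<exists>k z'. z' \<in> Z \<and> z = shift k (bisubst \<beta> z')"
    and two: "\<And>z i. z \<in> Z \<Longrightarrow> seq_factor z i 2 \<in> language A \<beta>"
  shows "Z \<subseteq> subst_space A \<beta>"
proof -
  have "seq_factor z i n \<in> language A \<beta>" if "z \<in> Z" for z i n
    using that
  proof (induction n arbitrary: z i rule: less_induct)
    case (less n)
    show ?case
    proof (cases "n \<le> 2")
      case True
      then show ?thesis
        using two[OF less.prems, of i] sublist_seq_factor[of i i n 2 z] sublist_language by auto
    next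
      case False
      obtain k z' where z': "z' \<in> Z" "z = shift k (bisubst \<beta> z')"
        using desub less.prems by blast
      have "seq_factor z' ((i + k) div 2) (n div 2 + 1) \<in> language A \<beta>"
        using False by (intro less.IH z') auto
      then show ?thesis
        using sublist_language[OF subst_word_language sublist_seq_factor_bisubst[OF Z[OF z'(1)]]]
        by (simp add: z'(2) seq_factor_shift)
    qed
  qed
  then show ?thesis by (auto intro: subst_spaceI)
qed

text \<open>A compactness argument: each central window of \<open>y\<close> is an image of a word
  for one of the two phases, and a phase that works for a window works for all smaller ones. With
  only two phases, one of them works for all windows. Injectivity of \<beta> then determines the
  letters of the preimage.\<close>

lemma desubstitution:
  assumes y: "y \<in> subst_space A \<beta>"
  obtains k y' where "y' \<in> subst_space A \<beta>" "y = shift k (bisubst \<beta> y')"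
proof -
  \<comment> \<open>The windows are centred at \<open>p\<close>, so that those of the same phase are
    nested and exhaust the integers.\<close>
  define good where "good p m \<longleftrightarrow> (\<exists>v\<in>language A \<beta>. length v = 2 * m \<and>
      seq_factor y (int p - 2 * int m) (4 * m) = subst_word \<beta> v)" for p m :: nat
  have mono: "good p l" if g: "good p m" and "l \<le> m" for p l m
  proof -
    obtain v where v: "v \<in> language A \<beta>" "length v = 2 * m"
      "seq_factor y (int p - 2 * int m) (4 * m) = subst_word \<beta> v"
      using g unfolding good_def by blast
    define u where "u = take (2 * l) (drop (m - l) v)"
    have u: "u \<in> language A \<beta>" using v(1) sublist_language sublist_take_drop unfolding u_def by blast
    have sv: "set v \<subseteq> A" "set u \<subseteq> A" using set_language v(1) u by auto
    have lu: "length u = 2 * l" using that v by (simp add: u_def)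
    have "seq_factor y (int p - 2 * int l) (4 * l) = subst_word \<beta> u"
    proof (rule nth_equalityI)
      fix i assume "i < length (seq_factor y (int p - 2 * int l) (4 * l))"
      then have i: "i < 4 * l" by simp
      have "subst_word \<beta> u ! i = \<beta> (u ! (i div 2)) ! (i mod 2)"
        using i lu by (intro nth_subst_word[OF sv(2)]) auto
      also have "u ! (i div 2) = v ! ((i + 2 * (m - l)) div 2)"
        using i that v(2) by (simp add: u_def add.commute)
      also have "i mod 2 = (i + 2 * (m - l)) mod 2" by simp
      also have "\<beta> (v ! ((i + 2 * (m - l)) div 2)) ! \<dots> = subst_word \<beta> v ! (i + 2 * (m - l))"
        using i that v(2) by (intro nth_subst_word[OF sv(1), symmetric]) auto
      also have "\<dots> = seq_factor y (int p - 2 * int m) (4 * m) ! (i + 2 * (m - l))"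
        by (simp add: v(3))
      also have "\<dots> = y (int p - 2 * int l + int i)"
        using i that by (subst nth_seq_factor) (auto simp: algebra_simps of_nat_diff)
      finally show "seq_factor y (int p - 2 * int l) (4 * l) ! i = subst_word \<beta> u ! i"
        using i by simp
    qed (simp add: length_subst_word[OF sv(2)] lu)
    then show ?thesis using u lu unfolding good_def by blast
  qed
  have ex: "good 0 m \<or> good 1 m" for m
  proof -
    \<comment> \<open>The extra letter leaves room to drop one at the left when the occurrence of
      \<open>w\<close> starts at an odd position, and 4m aligned letters still remain.\<close>
    define w where "w = seq_factor y (- 2 * int m) (4 * m + 1)"
    have "w \<in> language A \<beta>" unfolding w_def by (rule factor_language[OF y])
    then obtain v where v: "v \<in> language A \<beta>" "sublist w (subst_word \<beta> v)"
      using language_desubstitution by blast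
    have sv: "set v \<subseteq> A" using set_language v(1) by auto
    obtain k where k: "k + (4 * m + 1) \<le> 2 * length v" "w = take (4 * m + 1) (drop k (subst_word \<beta> v))"
      using v(2) unfolding sublist_iff_take_drop w_def length_seq_factor length_subst_word[OF sv] by blast
    define p where "p = k mod 2"
    define q where "q = (k + p) div 2"
    define u where "u = take (2 * m) (drop q v)"
    have kp: "k + p = 2 * q" "p \<le> 1" unfolding q_def p_def by presburger+
    have qv: "q \<le> length v" using k(1) kp by linarith
    have u: "u \<in> language A \<beta>" using v(1) sublist_language sublist_take_drop unfolding u_def by blast
    have su: "set u \<subseteq> A" using set_language u by auto
    have lu: "length u = 2 * m" using k kp by (simp add: u_def) 
    have "seq_factor y (int p - 2 * int m) (4 * m) = subst_word \<beta> u"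
    proof (rule nth_equalityI)
      fix i assume "i < length (seq_factor y (int p - 2 * int m) (4 * m))"
      then have i: "i < 4 * m" by simp
      have "subst_word \<beta> u ! i = \<beta> (u ! (i div 2)) ! (i mod 2)"
        using i lu by (intro nth_subst_word[OF su]) auto
      also have "u ! (i div 2) = v ! ((k + p + i) div 2)"
        using i qv unfolding kp(1) by (simp add: u_def)
      also have "i mod 2 = (k + p + i) mod 2" unfolding kp(1) by simp
      also have "\<beta> (v ! ((k + p + i) div 2)) ! \<dots> = subst_word \<beta> v ! (k + p + i)"
        using i k(1) kp by (intro nth_subst_word[OF sv, symmetric]) auto
      also have "\<dots> = w ! (p + i)"
        using i k kp(2) length_subst_word[OF sv] by (simp add: k(2) add.assoc)
      also have "\<dots> = y (int p - 2 * int m + int i)"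
        using i kp(2) unfolding w_def by (subst nth_seq_factor) (auto simp: algebra_simps)
      finally show "seq_factor y (int p - 2 * int m) (4 * m) ! i = subst_word \<beta> u ! i"
        using i by simp
    qed (simp add: length_subst_word[OF su] lu)
    then have "good p m" using u lu unfolding good_def by blast
    then show ?thesis using kp(2) by (cases p) auto
  qed
  have "\<exists>p. \<forall>m. good p m"
  proof (rule ccontr)
    assume "\<nexists>p. \<forall>m. good p m"
    then obtain a b where "\<not> good 0 a" "\<not> good 1 b" by blast
    then have "\<not> good 0 (max a b)" "\<not> good 1 (max a b)" using mono by (meson max.cobounded1 max.cobounded2)+
    then show False using ex by blast
  qed
  then obtain p where p: "\<And>m. good p m" by blast
  \<comment> \<open>Defining the preimage letter by letter through the inverse of \<beta> makes the
    words \<open>v\<close> found for different \<open>m\<close> agree automatically.\<close>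
  define y' where "y' i = inv_into A \<beta> [y (2 * i + int p), y (2 * i + 1 + int p)]" for i
  have main: "seq_factor y' (- int m) (2 * m) \<in> language A \<beta> \<and>
    (\<forall>i\<in>{- int m..<int m}. y' i \<in> A \<and> \<beta> (y' i) = [y (2 * i + int p), y (2 * i + 1 + int p)])" for m
  proof -
    obtain v where v: "v \<in> language A \<beta>" "length v = 2 * m"
      "seq_factor y (int p - 2 * int m) (4 * m) = subst_word \<beta> v"
      using p[of m] unfolding good_def by blast
    have sv: "set v \<subseteq> A" using set_language v(1) by auto
    have *: "y' (int j - int m) = v ! j \<and> \<beta> (v ! j) = [y (2 * (int j - int m) + int p), y (2 * (int j - int m) + 1 + int p)]"
      if j: "j < 2 * m" for j
    proof -
      have vA: "v ! j \<in> A" using sv j v(2) by (metis nth_mem subsetD)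
      have "subst_word \<beta> v ! (2 * j) = \<beta> (v ! j) ! 0" "subst_word \<beta> v ! (2 * j + 1) = \<beta> (v ! j) ! 1"
        using j v(2) nth_subst_word[OF sv, of "2 * j"] nth_subst_word[OF sv, of "2 * j + 1"] by auto
      moreover have "subst_word \<beta> v ! (2 * j) = y (2 * (int j - int m) + int p)"
         "subst_word \<beta> v ! (2 * j + 1) = y (2 * (int j - int m) + 1 + int p)"
        using j by (auto simp flip: v(3) simp: algebra_simps)
      ultimately have "\<beta> (v ! j) = [y (2 * (int j - int m) + int p), y (2 * (int j - int m) + 1 + int p)]"
        using image_eq[OF vA] by simp
      then show ?thesis unfolding y'_def using inv_into_f_f[OF inj vA] by metis
    qed
    have "seq_factor y' (- int m) (2 * m) = v"
      using * v(2) by (intro nth_equalityI) auto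
    moreover have "y' i \<in> A \<and> \<beta> (y' i) = [y (2 * i + int p), y (2 * i + 1 + int p)]"
      if "i \<in> {- int m..<int m}" for i
      using *[of "nat (i + int m)"] that sv v(2) nth_mem[of "nat (i + int m)" v] by auto
    ultimately show ?thesis using v(1) by blast
  qed
  have y'A: "\<beta> (y' i) = [y (2 * i + int p), y (2 * i + 1 + int p)]" for i
  proof -
    have "i \<in> {- int (nat \<bar>i\<bar> + 1)..<int (nat \<bar>i\<bar> + 1)}" by auto
    then show ?thesis using main by blast
  qed
  have "y' \<in> subst_space A \<beta>"
  proof (rule subst_spaceI)
    fix i n
    show "seq_factor y' i n \<in> language A \<beta>"
      by (rule sublist_language[OF conjunct1[OF main[of "nat \<bar>i\<bar> + n"]]], rule sublist_seq_factor) auto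
  qed
  moreover have "y = shift (- int p) (bisubst \<beta> y')"
  proof
    fix i :: int
    define j where "j = i - int p"
    have "j mod 2 = 0 \<or> j mod 2 = 1" by auto
    then show "y i = shift (- int p) (bisubst \<beta> y') i"
    proof
      assume "j mod 2 = 0"
      moreover then have "i = 2 * (j div 2) + int p" unfolding j_def by presburger
      ultimately show ?thesis unfolding shift_def bisubst_def y'A
        by (simp flip: j_def)
    next
      assume "j mod 2 = 1"
      moreover then have "i = 2 * (j div 2) + 1 + int p" unfolding j_def by presburger
      ultimately show ?thesis unfolding shift_def bisubst_def y'A
        by (simp flip: j_def)
    qed
  qed
  ultimately show thesis using that by blast
qed

lemma subst_pow_occurs:
  assumes "y \<in> subst_space A \<beta>"
  shows "\<exists>i. \<exists>a\<in>A. \<exists>m. seq_factor y i m = subst_pow \<beta> n a"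
  using assms
proof (induction n arbitrary: y)
  case 0
  have "seq_factor y 0 1 = [y 0]" by (simp add: seq_factor_def)
  then show ?case using value_in[OF 0] by auto
next
  case (Suc n)
  obtain k y' where y': "y' \<in> subst_space A \<beta>" "y = shift k (bisubst \<beta> y')"
    using desubstitution[OF Suc.prems] by blast
  then obtain i a m where ia: "a \<in> A" "seq_factor y' i m = subst_pow \<beta> n a"
    using Suc.IH by blast
  have s: "set (seq_factor y' i m) \<subseteq> A" using set_seq_factor range_subset[OF y'(1)] by fastforce
  have "seq_factor (bisubst \<beta> y') (2 * i) (2 * m) = subst_word \<beta> (seq_factor y' i m)"
    using seq_factor_bisubst[OF range_subset[OF y'(1)], of "2 * i" "2 * m" m] length_subst_word[OF s] by simp
  then have "seq_factor y (2 * i - k) (2 * m) = subst_pow \<beta> (Suc n) a"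
    by (simp add: y'(2) seq_factor_shift subst_pow_Suc ia)
  then show ?case using ia(1) by blast
qed

text \<open>Minimality in combinatorial form. Repeated desubstitution shows that every point
  contains arbitrarily high powers at some letter, and primitivity puts the desired word inside one
  of them.\<close>

lemma language_occurs:
  assumes "y \<in> subst_space A \<beta>" "w \<in> language A \<beta>"
  shows "\<exists>i. seq_factor y i (length w) = w"
proof -
  obtain b n where b: "b \<in> A" "sublist w (subst_pow \<beta> n b)"
    using assms(2) by (auto simp: language_def)
  obtain N where N: "\<forall>a\<in>A. A \<subseteq> set (subst_pow \<beta> N a)"
    using primitive by (auto simp: primitive_def)
  \<comment> \<open>The first \<open>N\<close> steps of the power reach every letter, in particular
    \<open>b\<close>; the remaining \<open>n\<close> steps turn \<open>b\<close> into a word that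
    contains \<open>w\<close>.\<close>
  obtain i a m where a: "a \<in> A" "seq_factor y i m = subst_pow \<beta> (n + N) a"
    using subst_pow_occurs[OF assms(1)] by blast
  have "b \<in> set (subst_pow \<beta> N a)" using N a b by blast
  then have "sublist w (seq_factor y i m)"
    unfolding a(2) by (rule sublist_order.order.trans[OF b(2) sublist_subst_pow])
  then obtain j where j: "j + length w \<le> m" "w = take (length w) (drop j (seq_factor y i m))"
    unfolding sublist_iff_take_drop length_seq_factor by blast
  then have "seq_factor y (i + int j) (length w) = w"
    using take_drop_seq_factor[of j "length w" m y i] by simp
  then show ?thesis by blast
qed

end

section \<open>Sliding block codes as continuous maps\<close>

lemma topspace_shift_topology:
  assumes "\<And>x. x \<in> X \<Longrightarrow> range x \<subseteq> A"
  shows "topspace (shift_topology A X) = X"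
  using assms by (auto simp: shift_topology_def PiE_def)

lemma openin_cylinder:
  assumes X: "\<And>x. x \<in> X \<Longrightarrow> range x \<subseteq> A" and I: "finite I" and z: "z \<in> X"
  shows "openin (shift_topology A X) {x \<in> X. \<forall>i\<in>I. x i = z i}"
proof -
  define S where "S i = (if i \<in> I then {z i} else A)" for i
  have "openin (product_topology (\<lambda>_. discrete_topology A) UNIV) (PiE UNIV S)"
  proof (rule iffD2[OF openin_PiE_gen], intro disjI2 conjI ballI)
    show "finite {i \<in> UNIV. S i \<noteq> topspace (discrete_topology A)}"
      by (rule finite_subset[OF _ I]) (auto simp: S_def)
    show "openin (discrete_topology A) (S i)" for i
      using X[OF z] by (auto simp: S_def)
  qed
  moreover have "{x \<in> X. \<forall>i\<in>I. x i = z i} = PiE UNIV S \<inter> X"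
    using X by (auto simp: S_def PiE_def Pi_def split: if_splits)
  ultimately show ?thesis
    unfolding shift_topology_def openin_subtopology by blast
qed

lemma open_contains_cylinder:
  assumes "openin (shift_topology A X) U" "x \<in> U"
  shows "\<exists>n::nat. {x' \<in> X. range x' \<subseteq> A \<and> (\<forall>i\<in>{- int n..int n}. x' i = x i)} \<subseteq> U"
proof -
  obtain V where V: "openin (product_topology (\<lambda>_. discrete_topology A) UNIV) V" "U = V \<inter> X"
    using assms(1) by (auto simp: shift_topology_def openin_subtopology)
  then obtain W where W: "x \<in> PiE UNIV W" "\<And>i. openin (discrete_topology A) (W i)"
    "finite {i. W i \<noteq> topspace (discrete_topology A)}" "PiE UNIV W \<subseteq> V"
    using product_topology_open_contains_basis[OF V(1), of x] assms(2) by auto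
  define J where "J = {i. W i \<noteq> A}"
  have "finite J" using W(3) by (simp add: J_def)
  define n where "n = Max (insert 0 ((\<lambda>i. nat \<bar>i\<bar>) ` J))"
  have n: "nat \<bar>i\<bar> \<le> n" if "i \<in> J" for i
    unfolding n_def using \<open>finite J\<close> that by (intro Max_ge) auto
  have "x' \<in> U" if x': "x' \<in> X" "range x' \<subseteq> A" "\<forall>i\<in>{- int n..int n}. x' i = x i" for x'
  proof -
    have "x' i \<in> W i" for i
    proof (cases "i \<in> J")
      case True
      then have "i \<in> {- int n..int n}" using n[OF True] by auto
      then show ?thesis using x' W(1) by (auto simp: PiE_def Pi_def)
    next
      case False
      then show ?thesis using x'(2) by (auto simp: J_def)
    qed
    then show ?thesis using W(4) V(2) x'(1) by (auto simp: PiE_def)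
  qed
  then show ?thesis by blast
qed

lemma continuous_map_block:
  assumes X: "\<And>x. x \<in> X \<Longrightarrow> range x \<subseteq> A" and Y: "\<And>y. y \<in> Y \<Longrightarrow> range y \<subseteq> B"
    and F: "\<And>x. x \<in> X \<Longrightarrow> block \<phi> a w x \<in> Y"
  shows "continuous_map (shift_topology A X) (shift_topology B Y) (block \<phi> a w)"
proof -
  have "continuous_map (shift_topology A X) (discrete_topology B) (\<lambda>x. block \<phi> a w x i)" for i
    unfolding continuous_map_def
  proof (intro conjI allI impI)
    show "(\<lambda>x. block \<phi> a w x i) \<in> topspace (shift_topology A X) \<rightarrow> topspace (discrete_topology B)"
      using Y[OF F] by (auto simp: topspace_shift_topology[OF X])
    fix U
    have "openin (shift_topology A X) {x \<in> X. block \<phi> a w x i \<in> U}"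
    proof (rule iffD2[OF openin_subopen], rule ballI)
      fix z assume z: "z \<in> {x \<in> X. block \<phi> a w x i \<in> U}"
      let ?T = "{x \<in> X. \<forall>j\<in>{i + a..<i + a + int w}. x j = z j}"
      have *: "seq_factor x (i + a) w = seq_factor z (i + a) w" if "x \<in> ?T" for x
        using that by (intro nth_equalityI) auto
      have "block \<phi> a w x i \<in> U" if "x \<in> ?T" for x
        using z unfolding block_def *[OF that] by simp
      then have "?T \<subseteq> {x \<in> X. block \<phi> a w x i \<in> U}"
        by blast
      moreover have "openin (shift_topology A X) ?T"
        using z by (intro openin_cylinder X) auto
      moreover have "z \<in> ?T" using z by auto
      ultimately show "\<exists>T. openin (shift_topology A X) T \<and> z \<in> T \<and> T \<subseteq> {x \<in> X. block \<phi> a w x i \<in> U}"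
        by blast
    qed
    then show "openin (shift_topology A X) {x \<in> topspace (shift_topology A X). block \<phi> a w x i \<in> U}"
      by (simp add: topspace_shift_topology[OF X])
  qed
  then have "continuous_map (shift_topology A X) (product_topology (\<lambda>_. discrete_topology B) UNIV) (block \<phi> a w)"
    by (simp add: continuous_map_componentwise_UNIV)
  then show ?thesis
    using F by (auto simp: shift_topology_def[of B] continuous_map_in_subtopology topspace_shift_topology[OF X])
qed

lemma topologically_conjugateI:
  assumes X: "\<And>x. x \<in> X \<Longrightarrow> range x \<subseteq> A" and Y: "\<And>y. y \<in> Y \<Longrightarrow> range y \<subseteq> B"
    and F: "\<And>x. x \<in> X \<Longrightarrow> block \<phi> a w x \<in> Y" and G: "\<And>y. y \<in> Y \<Longrightarrow> block \<psi> b v y \<in> X"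
    and GF: "\<And>x. x \<in> X \<Longrightarrow> block \<psi> b v (block \<phi> a w x) = x"
    and FG: "\<And>y. y \<in> Y \<Longrightarrow> block \<phi> a w (block \<psi> b v y) = y"
  shows "topologically_conjugate A X B Y"
proof -
  have "homeomorphic_maps (shift_topology A X) (shift_topology B Y) (block \<phi> a w) (block \<psi> b v)"
    unfolding homeomorphic_maps_def
    using continuous_map_block[OF X Y F] continuous_map_block[OF Y X G] GF FG
    by (simp add: topspace_shift_topology[OF X] topspace_shift_topology[OF Y])
  then have "homeomorphic_map (shift_topology A X) (shift_topology B Y) (block \<phi> a w)"
    using homeomorphic_maps_map by blast
  then show ?thesis
    unfolding topologically_conjugate_def by (auto simp: left_shift_eq block_shift)
qed

section \<open>Compactness and the Curtis-Hedlund-Lyndon theorem\<close>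

context doubling
begin

lemma finite_alphabet: "finite A"
  using substitution by (simp add: substitution_def)

lemma closedin_subst_space:
  "closedin (product_topology (\<lambda>_. discrete_topology A) UNIV) (subst_space A \<beta>)"
proof -
  let ?P = "product_topology (\<lambda>_::int. discrete_topology A) UNIV"
  have top: "topspace ?P = {x. range x \<subseteq> A}" by (auto simp: PiE_def)
  have sub: "?P = shift_topology A {x. range x \<subseteq> A}"
    unfolding shift_topology_def by (metis subtopology_topspace top)
  have "openin ?P (topspace ?P - subst_space A \<beta>)"
  proof (subst openin_subopen, intro ballI)
    fix z assume "z \<in> topspace ?P - subst_space A \<beta>"
    then have z: "range z \<subseteq> A" "z \<notin> subst_space A \<beta>" unfolding top by auto
    then obtain i n where n: "seq_factor z i n \<notin> language A \<beta>" by (auto simp: subst_space_def)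
    let ?T = "{x \<in> {x. range x \<subseteq> A}. \<forall>j\<in>{i..<i + int n}. x j = z j}"
    have "seq_factor x i n = seq_factor z i n" if "x \<in> ?T" for x
      using that by (intro nth_equalityI) auto
    then have "?T \<subseteq> topspace ?P - subst_space A \<beta>"
      using n factor_language[of _ i n] unfolding top by fastforce
    moreover have "openin ?P ?T"
      unfolding sub using z by (intro openin_cylinder) auto
    moreover have "z \<in> ?T" using z by auto
    ultimately show "\<exists>T. openin ?P T \<and> z \<in> T \<and> T \<subseteq> topspace ?P - subst_space A \<beta>" by blast
  qed
  then show ?thesis
    unfolding closedin_def top using range_subset by auto
qed

lemma compact_space_subst_space: "compact_space (shift_topology A (subst_space A \<beta>))"
proof -
  have "compact_space (product_topology (\<lambda>_::int. discrete_topology A) UNIV)"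
    by (simp add: compact_space_product_topology finite_alphabet compact_space_discrete_topology)
  then show ?thesis
    unfolding shift_topology_def
    by (intro compact_space_subtopology closedin_compact_space closedin_subst_space)
qed

text \<open>By continuity \<open>h x 0\<close> depends near each point on finitely many coordinates,
  and compactness makes their range uniform. Commutation with all shifts carries the rule from
  position 0 to every position.\<close>

lemma curtis_hedlund_lyndon:
  assumes cont: "continuous_map (shift_topology A (subst_space A \<beta>)) (shift_topology B Y) h"
    and Y: "\<And>y. y \<in> Y \<Longrightarrow> range y \<subseteq> B"
    and comm: "\<And>x. x \<in> subst_space A \<beta> \<Longrightarrow> h (left_shift x) = left_shift (h x)"
  shows "\<exists>\<phi> a w. \<forall>x\<in>subst_space A \<beta>. h x = block \<phi> a w x"
proof -
  let ?X = "subst_space A \<beta>" and ?T = "shift_topology A (subst_space A \<beta>)"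
  have top: "topspace ?T = ?X" by (rule topspace_shift_topology) (rule range_subset)
  define cyl where "cyl z n = {x \<in> ?X. \<forall>i\<in>{- int n..int n}. x i = z i}" for z n
  have open_cyl: "openin ?T (cyl z n)" if "z \<in> ?X" for z n
    unfolding cyl_def using that by (intro openin_cylinder range_subset) auto
  have "\<exists>n. \<forall>x'\<in>cyl x n. h x' 0 = h x 0" if x: "x \<in> ?X" for x
  proof -
    have hY: "h x \<in> Y" using cont x
      by (metis Y continuous_map_image_subset_topspace image_subset_iff top topspace_shift_topology)
    let ?U = "{x' \<in> topspace ?T. h x' \<in> {y \<in> Y. \<forall>i\<in>{0}. y i = h x i}}"
    have "openin ?T ?U"
      by (rule openin_continuous_map_preimage[OF cont]) (intro openin_cylinder Y hY, auto)
    moreover have "x \<in> ?U" using x hY top by auto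
    ultimately obtain n where "{x' \<in> ?X. range x' \<subseteq> A \<and> (\<forall>i\<in>{- int n..int n}. x' i = x i)} \<subseteq> ?U"
      using open_contains_cylinder by blast
    then show ?thesis using range_subset unfolding cyl_def by blast
  qed
  then obtain N where N: "\<And>x x'. x \<in> ?X \<Longrightarrow> x' \<in> cyl x (N x) \<Longrightarrow> h x' 0 = h x 0" by metis
  have "?X \<subseteq> \<Union> ((\<lambda>x. cyl x (N x)) ` ?X)" by (auto simp: cyl_def)
  then have "\<exists>\<F>. finite \<F> \<and> \<F> \<subseteq> (\<lambda>x. cyl x (N x)) ` ?X \<and> ?X \<subseteq> \<Union> \<F>"
    using open_cyl compact_space_subst_space[unfolded compact_space_def top]
    by (intro compactinD[of ?T]) auto
  then obtain \<F> where \<F>: "finite \<F>" "\<F> \<subseteq> (\<lambda>x. cyl x (N x)) ` ?X" "?X \<subseteq> \<Union> \<F>" by blast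
  from finite_subset_image[OF \<F>(1,2)]
  obtain S where S: "finite S" "S \<subseteq> ?X" "?X \<subseteq> (\<Union>x\<in>S. cyl x (N x))"
    using \<F>(3) by blast
  define n where "n = Max (insert 0 (N ` S))"
  have n: "N s \<le> n" if "s \<in> S" for s unfolding n_def using S that by (intro Max_ge) auto
  have local: "h x 0 = h x' 0"
    if x: "x \<in> ?X" "x' \<in> ?X" "seq_factor x (- int n) (2 * n + 1) = seq_factor x' (- int n) (2 * n + 1)" for x x'
  proof -
    have eq: "x i = x' i" if "i \<in> {- int n..int n}" for i
    proof -
      have "seq_factor x (- int n) (2 * n + 1) ! nat (i + int n) = seq_factor x' (- int n) (2 * n + 1) ! nat (i + int n)"
        using x(3) by simp
      then show ?thesis using that by (subst (asm) (1 2) nth_seq_factor) auto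
    qed
    obtain s where s: "s \<in> S" "x \<in> cyl s (N s)" using S(3) x(1) by blast
    have "x' \<in> cyl s (N s)" using s n[OF s(1)] eq x(2) unfolding cyl_def by fastforce
    then show ?thesis using N s S(2) by (metis subsetD)
  qed
  have comm1: "h (shift 1 x) = shift 1 (h x)" if "x \<in> ?X" for x
    using comm[OF that] by (simp add: left_shift_eq)
  have shift_comm: "h (shift k x) = shift k (h x)" if "x \<in> ?X" for x k
  proof (induction k rule: int_induct[where k = 0])
    case base
    show ?case by simp
  next
    case (step1 k)
    then show ?case using comm1[OF shift_in_space[OF that, of k]] by (simp add: shift_shift add.commute)
  next
    case (step2 k)
    have "shift 1 (h (shift (k - 1) x)) = shift 1 (shift (k - 1) (h x))"
      using comm1[OF shift_in_space[OF that, of "k - 1"]] step2 by (simp add: shift_shift)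
    then have "shift (- 1) (shift 1 (h (shift (k - 1) x))) = shift (- 1) (shift 1 (shift (k - 1) (h x)))"
      by simp
    then show ?case unfolding shift_shift by simp
  qed
  \<comment> \<open>For a word that occurs, any representative point gives the same value by
    \<open>local\<close>; a word that does not occur gets an arbitrary value.\<close>
  define \<phi> where "\<phi> u = h (SOME x. x \<in> ?X \<and> seq_factor x (- int n) (2 * n + 1) = u) 0" for u
  have "h x = block \<phi> (- int n) (2 * n + 1) x" if x: "x \<in> ?X" for x
  proof
    fix i
    let ?u = "seq_factor x (i + - int n) (2 * n + 1)"
    have sx: "shift i x \<in> ?X" "seq_factor (shift i x) (- int n) (2 * n + 1) = ?u"
      using x shift_in_space by (auto simp: seq_factor_shift add.commute)
    define x' where "x' = (SOME x. x \<in> ?X \<and> seq_factor x (- int n) (2 * n + 1) = ?u)"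
    have "x' \<in> ?X \<and> seq_factor x' (- int n) (2 * n + 1) = ?u"
      unfolding x'_def by (rule someI_ex[of "\<lambda>x. x \<in> ?X \<and> seq_factor x (- int n) (2 * n + 1) = ?u"]) (use sx in blast)
    then have "h x' 0 = h (shift i x) 0" using local sx by metis
    also have "\<dots> = h x i" unfolding shift_comm[OF x] by (simp add: shift_def)
    finally show "h x i = block \<phi> (- int n) (2 * n + 1) x i"
      unfolding block_def \<phi>_def x'_def by simp
  qed
  then show ?thesis by blast
qed

end

lemma seq_factor_block_cong:
  assumes "seq_factor x (i + a) (n + w) = seq_factor y (j + a) (n + w)"
  shows "seq_factor (block \<phi> a w x) i n = seq_factor (block \<phi> a w y) j n"
proof (rule nth_equalityI)
  fix k assume "k < length (seq_factor (block \<phi> a w x) i n)"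
  then have k: "k < n" by simp
  have "seq_factor x (i + int k + a) w = take w (drop k (seq_factor x (i + a) (n + w)))"
    using k by (subst take_drop_seq_factor) (auto simp: algebra_simps)
  also have "\<dots> = seq_factor y (j + int k + a) w"
    unfolding assms using k by (subst take_drop_seq_factor) (auto simp: algebra_simps)
  finally show "seq_factor (block \<phi> a w x) i n ! k = seq_factor (block \<phi> a w y) j n ! k"
    using k by (simp add: block_def)
qed simp

lemma seq_factor_mono_cong:
  assumes "seq_factor x i n = seq_factor y j n" "m + l \<le> n"
  shows "seq_factor x (i + int m) l = seq_factor y (j + int m) l"
  using assms by (metis take_drop_seq_factor)

section \<open>The Thue-Morse system\<close>

definition tm2 :: "nat list list" where
  "tm2 = [[0,0], [0,1], [1,0], [1,1]]"

text \<open>The lexicographic order matters: complementing all letters exchanges positions i and 5 -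
  i. A labelling stored along this list is invariant under complementation exactly when it equals
  its own reversal.\<close>

definition tm3 :: "nat list list" where
  "tm3 = [[0,0,1], [0,1,0], [0,1,1], [1,0,0], [1,0,1], [1,1,0]]"

definition tm4 :: "nat list list" where
  "tm4 = [[0,0,1,0], [0,0,1,1], [0,1,0,0], [0,1,0,1], [0,1,1,0],
          [1,0,0,1], [1,0,1,0], [1,0,1,1], [1,1,0,0], [1,1,0,1]]"

abbreviation flip :: "nat \<Rightarrow> nat" where
  "flip c \<equiv> 1 - c"

text \<open>Turns the factor relation into a bounded test of windows that evaluation can
  decide.\<close>

lemma sublist_iff_in_windows:
  "sublist xs ys \<longleftrightarrow> list_ex (\<lambda>m. take (length xs) (drop m ys) = xs) [0..<Suc (length ys)]"
proof
  assume "sublist xs ys"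
  then obtain m where "m + length xs \<le> length ys" "xs = take (length xs) (drop m ys)"
    unfolding sublist_iff_take_drop by blast
  then show "list_ex (\<lambda>m. take (length xs) (drop m ys) = xs) [0..<Suc (length ys)]"
    unfolding list_ex_iff by (intro bexI[of _ m]) auto
next
  assume "list_ex (\<lambda>m. take (length xs) (drop m ys) = xs) [0..<Suc (length ys)]"
  then show "sublist xs ys"
    unfolding list_ex_iff by (metis sublist_take_drop)
qed

interpretation tm: doubling "{0, 1}" thue_morse
proof
  show "Defs.substitution {0, 1} thue_morse" by (auto simp: substitution_def thue_morse_def)
  show "Defs.constant_length {0, 1} thue_morse 2" by (auto simp: constant_length_def thue_morse_def)
  show "inj_on thue_morse {0, 1}" by (auto simp: inj_on_def thue_morse_def)
  show "Defs.primitive {0, 1} thue_morse"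
    unfolding primitive_def
    by (intro exI[of _ 1]) (auto simp: subst_pow_def subst_word_def thue_morse_def)
qed

lemma tm_space: "thue_morse_space = subst_space {0, 1} thue_morse"
  by (simp add: thue_morse_space_def)

lemma tm4_language: "u \<in> set tm4 \<Longrightarrow> u \<in> language {0, 1} thue_morse"
proof -
  assume u: "u \<in> set tm4"
  \<comment> \<open>The fifth power has 32 letters, long enough to show all ten words of length
    four.\<close>
  have "list_all (\<lambda>u. sublist u (subst_pow thue_morse 5 0)) tm4"
    unfolding sublist_iff_in_windows by code_simp
  then have "sublist u (subst_pow thue_morse 5 0)" using u by (auto simp: list_all_iff)
  then show ?thesis unfolding language_def by (auto intro!: exI[of _ 5])
qed

lemma length2_in_tm2: "length u = 2 \<Longrightarrow> set u \<subseteq> {0, 1} \<Longrightarrow> u \<in> set tm2"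
  by (auto simp: tm2_def length_Suc_conv numeral_2_eq_2)

lemma tm2_language: "u \<in> set tm2 \<Longrightarrow> u \<in> language {0, 1} thue_morse"
proof -
  assume u: "u \<in> set tm2"
  have "list_all (\<lambda>u. list_ex (\<lambda>v. take 2 v = u) tm4) tm2" by code_simp
  then obtain v where "v \<in> set tm4" "u = take 2 v" using u by (auto simp: list_all_iff list_ex_iff)
  then show ?thesis using tm4_language tm.sublist_language by (metis sublist_take)
qed

lemma tm3_language: "u \<in> set tm3 \<Longrightarrow> u \<in> language {0, 1} thue_morse"
proof -
  assume u: "u \<in> set tm3"
  have "list_all (\<lambda>u. list_ex (\<lambda>v. take 3 v = u) tm4) tm3" by code_simp
  then obtain v where "v \<in> set tm4" "u = take 3 v" using u by (auto simp: list_all_iff list_ex_iff)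
  then show ?thesis using tm4_language tm.sublist_language by (metis sublist_take)
qed

text \<open>A factor of length n at phase at most one fits into the image of m letters once n + 1 <=
  2m. This leads from the factors of length two to those of length three, and from these to length
  four.\<close>

lemma tm_factor_step:
  assumes "x \<in> thue_morse_space" "n + 1 \<le> 2 * m"
  obtains y i' r where "y \<in> thue_morse_space" "r < 2"
    "seq_factor x i n = take n (drop r (subst_word thue_morse (seq_factor y i' m)))"
proof -
  obtain k y where y: "y \<in> thue_morse_space" "x = shift k (bisubst thue_morse y)"
    using assms(1) unfolding tm_space by (rule tm.desubstitution)
  have "(i + k) mod 2 < 2" by simp
  then have "nat ((i + k) mod 2) + n \<le> 2 * m" "nat ((i + k) mod 2) < 2" using assms(2) by auto
  then show thesis
    using that[OF y(1)] tm.seq_factor_bisubst tm.range_subset y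
    unfolding tm_space y(2) seq_factor_shift by metis
qed

lemma tm_factor2:
  assumes "x \<in> thue_morse_space" shows "seq_factor x i 2 \<in> set tm2"
  using assms tm.range_subset[of x] set_seq_factor[of x i 2]
  by (intro length2_in_tm2) (auto simp: tm_space)

lemma tm_factor3:
  assumes "x \<in> thue_morse_space" shows "seq_factor x i 3 \<in> set tm3"
proof -
  obtain y i' r where y: "y \<in> thue_morse_space" "r < 2"
    "seq_factor x i 3 = take 3 (drop r (subst_word thue_morse (seq_factor y i' 2)))"
    by (rule tm_factor_step[OF assms, of 3 2 i]) auto
  have "list_all (\<lambda>u. list_all (\<lambda>r. take 3 (drop r (subst_word thue_morse u)) \<in> set tm3) [0..<2]) tm2"
    by code_simp
  then show ?thesis using y(2,3) tm_factor2[OF y(1)] by (auto simp: list_all_iff)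
qed

lemma tm_factor4:
  assumes "x \<in> thue_morse_space" shows "seq_factor x i 4 \<in> set tm4"
proof -
  obtain y i' r where y: "y \<in> thue_morse_space" "r < 2"
    "seq_factor x i 4 = take 4 (drop r (subst_word thue_morse (seq_factor y i' 3)))"
    by (rule tm_factor_step[OF assms, of 4 3 i]) auto
  have "list_all (\<lambda>u. list_all (\<lambda>r. take 4 (drop r (subst_word thue_morse u)) \<in> set tm4) [0..<2]) tm3"
    by code_simp
  then show ?thesis using y(2,3) tm_factor3[OF y(1)] by (auto simp: list_all_iff)
qed

lemma tm_value: "x \<in> thue_morse_space \<Longrightarrow> x i = 0 \<or> x i = 1"
  using tm.value_in by (auto simp: tm_space)

text \<open>All four binary words of length two are Thue-Morse factors, so the two-letter condition
  of \<open>space_if_self_desubstituting\<close> holds automatically here.\<close>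

lemma tm_spaceI:
  assumes Z: "\<And>z i. z \<in> Z \<Longrightarrow> z i = 0 \<or> z i = 1"
    and desub: "\<And>z. z \<in> Z \<Longrightarrow> \<exists>k z'. z' \<in> Z \<and> z = shift k (bisubst thue_morse z')"
  shows "Z \<subseteq> thue_morse_space"
  unfolding tm_space
proof (rule tm.space_if_self_desubstituting[OF _ desub])
  fix z i assume z: "z \<in> Z"
  show "range z \<subseteq> {0, 1}"
    using Z[OF z] by (metis image_subsetI insertCI)
  then show "seq_factor z i 2 \<in> language {0, 1} thue_morse"
    using set_seq_factor[of z i 2] by (intro tm2_language length2_in_tm2) auto
qed

lemma bisubst_flip:
  assumes "\<And>i. x i = 0 \<or> x i = 1"
  shows "bisubst thue_morse (\<lambda>i. flip (x i)) = (\<lambda>i. flip (bisubst thue_morse x i))"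
proof
  fix i :: int
  have "i mod 2 = 0 \<or> i mod 2 = 1" by auto
  then show "bisubst thue_morse (\<lambda>i. flip (x i)) i = flip (bisubst thue_morse x i)"
    using assms[of "i div 2"] by (auto simp: bisubst_def thue_morse_def)
qed

lemma flip_in_space:
  assumes "x \<in> thue_morse_space"
  shows "(\<lambda>i. flip (x i)) \<in> thue_morse_space"
proof -
  have "(\<lambda>x i. flip (x i)) ` thue_morse_space \<subseteq> thue_morse_space"
  proof (rule tm_spaceI)
    fix z assume "z \<in> (\<lambda>x i. flip (x i)) ` thue_morse_space"
    then obtain x where x: "x \<in> thue_morse_space" "z = (\<lambda>i. flip (x i))" by blast
    show "z i = 0 \<or> z i = 1" for i using tm_value[OF x(1), of i] by (auto simp: x(2))
    obtain k y where y: "y \<in> thue_morse_space" "x = shift k (bisubst thue_morse y)"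
      using x(1) unfolding tm_space by (rule tm.desubstitution)
    have "z = shift k (bisubst thue_morse (\<lambda>i. flip (y i)))"
      using bisubst_flip[OF tm_value[OF y(1)]] by (simp add: x(2) y(2) shift_def)
    then show "\<exists>k z'. z' \<in> (\<lambda>x i. flip (x i)) ` thue_morse_space \<and> z = shift k (bisubst thue_morse z')"
      using y(1) by blast
  qed
  then show ?thesis using assms by blast
qed

fun thue_morse_bit :: "nat \<Rightarrow> nat" where
  "thue_morse_bit n = (if n = 0 then 0
     else if even n then thue_morse_bit (n div 2) else flip (thue_morse_bit (n div 2)))"

declare thue_morse_bit.simps [simp del]

lemma thue_morse_bit_cases: "thue_morse_bit n = 0 \<or> thue_morse_bit n = 1"
proof (induction n rule: less_induct)
  case (less n)
  have "n = 0 \<or> n div 2 < n" by auto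
  then show ?case using less[of "n div 2"] by (subst (1 2) thue_morse_bit.simps) auto
qed

lemma thue_morse_space_nonempty: "thue_morse_space \<noteq> {}"
proof -
  text \<open>The two-sided word with mirror-symmetric Thue-Morse halves has period two under the
    substitution: the right half is fixed and the left half is exchanged with its complement.\<close>
  define z where "z b i = (if i \<ge> 0 then thue_morse_bit (nat i)
    else if b then thue_morse_bit (nat (- 1 - i)) else flip (thue_morse_bit (nat (- 1 - i))))" for b i
  have bit: "thue_morse_bit (2 * n) = thue_morse_bit n"
    "thue_morse_bit (2 * n + 1) = flip (thue_morse_bit n)" for n
    by (subst thue_morse_bit.simps, auto)+
  have z_cases: "z b i = 0 \<or> z b i = 1" for b i
    using thue_morse_bit_cases unfolding z_def by (metis diff_self_eq_0 diff_zero)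
  have zz: "z b (2 * q) = z (\<not> b) q" "z b (2 * q + 1) = flip (z (\<not> b) q)" for b q
  proof -
    have "z b (2 * q) = z (\<not> b) q \<and> z b (2 * q + 1) = flip (z (\<not> b) q)"
    proof (cases "q \<ge> 0")
      case True
      then have n: "nat (2 * q) = 2 * nat q" "nat (2 * q + 1) = 2 * nat q + 1"
        "2 * q \<ge> 0" "2 * q + 1 \<ge> 0" by auto
      show ?thesis unfolding z_def n using True n(3,4) by (simp only: bit if_True)
    next
      case False
      \<comment> \<open>The reflection i -> -1 - i reverses the order inside each block of two. The
        even position thus reads the complemented bit of the mirrored half, which is why
        \<open>b\<close> is negated at each substitution.\<close>
      then have n: "nat (- 1 - 2 * q) = 2 * nat (- 1 - q) + 1" "nat (- 1 - (2 * q + 1)) = 2 * nat (- 1 - q)"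
        "\<not> 2 * q \<ge> 0" "\<not> 2 * q + 1 \<ge> 0" by auto
      show ?thesis
        unfolding z_def n using False n(3,4) thue_morse_bit_cases[of "nat (- 1 - q)"]
        by (cases b) (simp_all only: bit if_False if_True not_True_eq_False not_False_eq_True, auto)
    qed
    then show "z b (2 * q) = z (\<not> b) q" "z b (2 * q + 1) = flip (z (\<not> b) q)" by auto
  qed
  have "z b = bisubst thue_morse (z (\<not> b))" for b
  proof
    fix i :: int
    have "i = 2 * (i div 2) \<and> i mod 2 = 0 \<or> i = 2 * (i div 2) + 1 \<and> i mod 2 = 1" by presburger
    then show "z b i = bisubst thue_morse (z (\<not> b)) i"
      using zz[of b "i div 2"] z_cases[of "\<not> b" "i div 2"]
      by (auto simp: bisubst_def thue_morse_def)
  qed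
  then have desub: "\<exists>k z'. z' \<in> range z \<and> z b = shift k (bisubst thue_morse z')" for b
    by (metis rangeI shift_0)
  have "range z \<subseteq> thue_morse_space"
  proof (rule tm_spaceI)
    fix x assume "x \<in> range z"
    then obtain b where b: "x = z b" by blast
    show "x i = 0 \<or> x i = 1" for i
      unfolding b by (rule z_cases)
    show "\<exists>k z'. z' \<in> range z \<and> x = shift k (bisubst thue_morse z')"
      using desub b by simp
  qed
  then show ?thesis by blast
qed

text \<open>A finite certificate for a conjugacy. The middle letter of \<open>u\<close> fills
  positions 2 and 3 of its six-letter image, and the radius-one windows around them start at 1 and
  2; so \<open>rel\<close> says that the code \<open>F\<close> satisfies F o \<theta> = \<beta> o F
  o s. The image of \<open>F\<close> is then closed under desubstitution and \<open>two\<close>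
  places it in the system. The letter map inverts \<open>F\<close> on its image, and since every
  factor of the system occurs in one image point, it inverts \<open>F\<close> everywhere.\<close>

lemma (in doubling) thue_morse_conjugateI:
  fixes \<phi> :: "nat list \<Rightarrow> 'a" and \<psi> :: "'a \<Rightarrow> nat" and s :: "nat \<Rightarrow> nat"
  assumes s: "s = id \<or> s = flip"
    and maps: "\<And>u. u \<in> set tm3 \<Longrightarrow> \<phi> u \<in> A"
    and two: "\<And>u. u \<in> set tm4 \<Longrightarrow> [\<phi> (take 3 u), \<phi> (drop 1 u)] \<in> language A \<beta>"
    and rel: "\<And>u. u \<in> set tm3 \<Longrightarrow> \<beta> (\<phi> (map s u)) =
      [\<phi> (take 3 (drop 1 (subst_word thue_morse u))), \<phi> (take 3 (drop 2 (subst_word thue_morse u)))]"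
    and inv: "\<And>u. u \<in> set tm3 \<Longrightarrow> \<psi> (\<phi> u) = u ! d" and d: "d < 3"
  shows "topologically_conjugate A (subst_space A \<beta>) {0, 1} thue_morse_space"
proof -
  let ?X = thue_morse_space and ?Y = "subst_space A \<beta>"
  define F where "F = block \<phi> (- 1) 3"
  \<comment> \<open>The label at position j comes from letters j - 1, j, j + 1, and
    \<open>\<psi>\<close> recovers letter j - 1 + d. To read letter i one looks at the label at j =
    i + 1 - d.\<close>
  define G where "G = block (\<lambda>v. \<psi> (v ! 0)) (1 - int d) 1"
  have rangeF: "range (F x) \<subseteq> A" if "x \<in> ?X" for x
    using maps tm_factor3[OF that] by (auto simp: F_def block_def)
  have s_in: "(\<lambda>i. s (x i)) \<in> ?X" if "x \<in> ?X" for x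
    using s flip_in_space[OF that] that by auto
  have F\<theta>: "F (bisubst thue_morse x) = bisubst \<beta> (F (\<lambda>i. s (x i)))" if x: "x \<in> ?X" for x
  proof
    fix i :: int
    define j where "j = i div 2"
    define u where "u = seq_factor x (j - 1) 3"
    have u: "u \<in> set tm3" unfolding u_def by (rule tm_factor3[OF x])
    have su: "seq_factor (\<lambda>i. s (x i)) (j - 1) 3 = map s u"
      by (simp add: u_def seq_factor_def)
    have w: "subst_word thue_morse u = seq_factor (bisubst thue_morse x) (2 * (j - 1)) 6"
      using tm.seq_factor_bisubst[of x "2 * (j - 1)" 6 3] x tm.range_subset[of x]
        tm.length_subst_word[of u] set_seq_factor[of x "j - 1" 3]
      by (auto simp: u_def tm_space)
    have F01: "F (bisubst thue_morse x) (2 * j + int k) = \<phi> (take 3 (drop (k + 1) (subst_word thue_morse u)))"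
      if "k < 2" for k
      unfolding w F_def block_def using that by (subst take_drop_seq_factor) (auto simp: algebra_simps)
    have "\<beta> (F (\<lambda>i. s (x i)) j) = [F (bisubst thue_morse x) (2 * j), F (bisubst thue_morse x) (2 * j + 1)]"
      using rel[OF u] su F01[of 0] F01[of 1] by (simp add: F_def block_def numeral_2_eq_2)
    moreover have "i = 2 * j \<and> i mod 2 = 0 \<or> i = 2 * j + 1 \<and> i mod 2 = 1" unfolding j_def by presburger
    ultimately show "F (bisubst thue_morse x) i = bisubst \<beta> (F (\<lambda>i. s (x i))) i"
      unfolding bisubst_def j_def[symmetric] by auto
  qed
  have F_in: "F x \<in> ?Y" if "x \<in> ?X" for x
  proof -
    have "F ` ?X \<subseteq> ?Y"
    proof (rule space_if_self_desubstituting)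
      fix z assume "z \<in> F ` ?X"
      then obtain x where x: "x \<in> ?X" "z = F x" by blast
      show "range z \<subseteq> A" using rangeF x by blast
      obtain k y where y: "y \<in> thue_morse_space" "x = shift k (bisubst thue_morse y)"
        using x(1) unfolding tm_space by (rule tm.desubstitution)
      have "z = shift k (bisubst \<beta> (F (\<lambda>i. s (y i))))"
        unfolding x(2) y(2) F\<theta>[OF y(1), symmetric] unfolding F_def block_shift ..
      then show "\<exists>k z'. z' \<in> F ` ?X \<and> z = shift k (bisubst \<beta> z')"
        using s_in[OF y(1)] by blast
      fix i
      let ?u = "seq_factor x (i - 1) 4"
      have "seq_factor z i 2 = [F x i, F x (i + 1)]"
        by (simp add: x(2) seq_factor_def numeral_2_eq_2)
      also have "\<dots> = [\<phi> (take 3 ?u), \<phi> (drop 1 ?u)]"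
        using take_drop_seq_factor[of 1 3 4 x "i - 1"] take_drop_seq_factor[of 0 3 4 x "i - 1"]
        by (simp add: F_def block_def)
      finally show "seq_factor z i 2 \<in> language A \<beta>"
        using two[OF tm_factor4[OF x(1)]] by simp
    qed
    then show ?thesis using that by blast
  qed
  have GF: "G (F x) = x" if "x \<in> ?X" for x
  proof
    fix i
    have "G (F x) i = \<psi> (\<phi> (seq_factor x (i - int d) 3))"
      by (simp add: G_def F_def block_def)
    also have "\<dots> = x i" using inv[OF tm_factor3[OF that]] d by simp
    finally show "G (F x) i = x i" .
  qed
  obtain x0 where x0: "x0 \<in> ?X" using thue_morse_space_nonempty by blast
  have occ: "\<exists>j. seq_factor z i n = seq_factor (F x0) j n" if "z \<in> ?Y" for z i n
    using language_occurs[OF F_in[OF x0] factor_language[OF that, of i n]] by (metis length_seq_factor)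
  have G_in: "G z \<in> ?X" if "z \<in> ?Y" for z
    unfolding tm_space
  proof (rule tm.subst_spaceI)
    fix i n
    obtain j where "seq_factor z (i + (1 - int d)) (n + 1) = seq_factor (F x0) j (n + 1)"
      using occ[OF \<open>z \<in> ?Y\<close>] by blast
    then have "seq_factor (G z) i n = seq_factor (G (F x0)) (j - (1 - int d)) n"
      unfolding G_def by (intro seq_factor_block_cong) simp
    then show "seq_factor (G z) i n \<in> language {0, 1} thue_morse"
      using GF[OF x0] tm.factor_language x0 unfolding tm_space by metis
  qed
  have FG: "F (G z) = z" if z: "z \<in> ?Y" for z
  proof
    fix i
    \<comment> \<open>These six letters contain the four compared next for each
      \<open>d < 3\<close>, and position \<open>i\<close> is their entry 2.\<close>
    obtain j where j: "seq_factor z (i - 2) 6 = seq_factor (F x0) j 6" using occ[OF z] by blast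
    have "seq_factor z (i - 2 + int (2 - d)) 4 = seq_factor (F x0) (j + int (2 - d)) 4"
      using d by (intro seq_factor_mono_cong[OF j]) auto
    then have "seq_factor z (i - int d) 4 = seq_factor (F x0) (j + 2 - int d) 4"
      using d by (simp add: of_nat_diff algebra_simps)
    then have "seq_factor (G z) (i - 1) 3 = seq_factor (G (F x0)) (j + 1) 3"
      unfolding G_def by (intro seq_factor_block_cong) (simp add: algebra_simps)
    then have "F (G z) i = F x0 (j + 2)"
      unfolding GF[OF x0] by (simp add: F_def block_def algebra_simps)
    also have "\<dots> = seq_factor (F x0) j 6 ! 2" by simp
    also have "\<dots> = z i" by (simp flip: j)
    finally show "F (G z) i = z i" .
  qed
  show ?thesis
    using topologically_conjugateI[of ?Y A ?X "{0, 1}" "\<lambda>v. \<psi> (v ! 0)" "1 - int d" 1 \<phi> "- 1" 3]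
      range_subset tm.range_subset F_in G_in GF FG
    unfolding F_def G_def tm_space by blast
qed

section \<open>Renormalization of conjugacies\<close>

lemma block_pad:
  assumes "b \<le> a" "a + int w \<le> b + int v"
  shows "\<exists>\<psi>. block \<psi> b v = block \<phi> a w"
proof -
  have "block (\<lambda>u. \<phi> (take w (drop (nat (a - b)) u))) b v x i = block \<phi> a w x i" for x i
    unfolding block_def using assms by (subst take_drop_seq_factor) (auto simp: algebra_simps)
  then show ?thesis by blast
qed

lemma shift_inj: "shift k x = shift k y \<Longrightarrow> x = y"
  by (metis add.left_inverse shift_0 shift_shift)

lemma tm_bisubst: "x \<in> thue_morse_space \<Longrightarrow> bisubst thue_morse x \<in> thue_morse_space"
  unfolding tm_space by (rule tm.bisubst_in_space)

lemma tm_occurs: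
  assumes "x \<in> thue_morse_space" "y \<in> thue_morse_space"
  shows "\<exists>j. seq_factor y j n = seq_factor x i n"
  using tm.language_occurs[of y "seq_factor x i n"] tm.factor_language[of x i n] assms
  unfolding tm_space by auto

lemma bisubst_double:
  "bisubst \<beta> y (2 * i) = \<beta> (y i) ! 0" "bisubst \<beta> y (2 * i + 1) = \<beta> (y i) ! 1"
  by (simp_all add: bisubst_def)

lemma seq_factor_2: "seq_factor x i 2 = [x i, x (i + 1)]"
  by (simp add: seq_factor_def numeral_2_eq_2)

context doubling
begin

text \<open>Injectivity into the system is the property that renormalisation transports; that the
  image shows all words of the language follows by minimality in
  \<open>embedding_covers_language\<close>.\<close>

definition embeds :: "((int \<Rightarrow> nat) \<Rightarrow> int \<Rightarrow> 'a) \<Rightarrow> bool" where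
  "embeds F \<longleftrightarrow> F ` thue_morse_space \<subseteq> subst_space A \<beta> \<and> inj_on F thue_morse_space"

lemma embeds_offset:
  assumes "embeds (block \<phi> a w)" shows "embeds (block \<phi> b w)"
proof -
  have eq: "block \<phi> b w = (\<lambda>x. shift (b - a) (block \<phi> a w x))"
    by (simp add: shift_block)
  show ?thesis
    using assms shift_in_space unfolding embeds_def eq by (auto simp: inj_on_def dest: shift_inj)
qed

text \<open>Since the image of a substituted point is desubstitutable and all points of the Thue-Morse
  system have the same finite words, one parity of the offset serves all points at once.\<close>
lemma renormalize:
  assumes emb: "embeds (block \<phi> 0 w)"
  obtains k where "\<And>a w'. a mod 2 = k mod 2 \<Longrightarrow> nat (a mod 2) + w + 1 \<le> 2 * w' \<Longrightarrow>
    \<exists>\<phi>'. embeds (block \<phi>' (a div 2) w') \<and>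
      (\<forall>x\<in>thue_morse_space. block \<phi> a w (bisubst thue_morse x) = bisubst \<beta> (block \<phi>' (a div 2) w' x))"
proof -
  let ?X = thue_morse_space and ?Y = "subst_space A \<beta>"
  obtain x0 where x0: "x0 \<in> ?X" using thue_morse_space_nonempty by blast
  have "block \<phi> 0 w (bisubst thue_morse x0) \<in> ?Y"
    using emb tm_bisubst[OF x0] by (auto simp: embeds_def)
  then obtain k y where y: "y \<in> ?Y" "block \<phi> 0 w (bisubst thue_morse x0) = shift k (bisubst \<beta> y)"
    by (rule desubstitution)
  show thesis
  proof (rule that[of k])
    fix a w' assume a: "a mod 2 = k mod 2" and w': "nat (a mod 2) + w + 1 \<le> 2 * w'"
    define b where "b = a div 2"
    define r where "r = nat (a mod 2)"
    have abr: "a = 2 * b + int r" unfolding b_def r_def by simp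
    define z where "z = shift ((a + k) div 2) y"
    have z: "z \<in> ?Y" unfolding z_def by (rule shift_in_space[OF y(1)])
    \<comment> \<open>Equal parities make the total shift even, so it can be moved through \<beta>
      and absorbed into \<open>y\<close>.\<close>
    have "a + k = 2 * ((a + k) div 2)" using a by presburger
    then have block0: "block \<phi> a w (bisubst thue_morse x0) = bisubst \<beta> z"
      unfolding z_def shift_bisubst[symmetric] by (metis add_0 shift_block shift_shift y(2))
    \<comment> \<open>The two values are those of the old code at an even and the following odd
      position. Their windows start at \<open>r\<close> and \<open>r + 1\<close> in the 2w' letters
      of the substituted word, hence the bound \<open>r + w + 1 <= 2 * w'\<close>.\<close>
    define \<phi>' where "\<phi>' u = inv_into A \<beta>
      [\<phi> (take w (drop r (subst_word thue_morse u))), \<phi> (take w (drop (r + 1) (subst_word thue_morse u)))]" for u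
    let ?F' = "block \<phi>' b w'"
    have F': "?F' x i = inv_into A \<beta> [block \<phi> a w (bisubst thue_morse x) (2 * i), block \<phi> a w (bisubst thue_morse x) (2 * i + 1)]"
      if x: "x \<in> ?X" for x i
    proof -
      let ?u = "seq_factor x (i + b) w'"
      have "set ?u \<subseteq> {0, 1}" using set_seq_factor[of x "i + b" w'] tm.range_subset[of x] x by (auto simp: tm_space)
      then have u: "subst_word thue_morse ?u = seq_factor (bisubst thue_morse x) (2 * (i + b)) (2 * w')"
        using tm.seq_factor_bisubst[of x "2 * (i + b)" "2 * w'" w'] x tm.range_subset[of x]
          tm.length_subst_word[of ?u] by (auto simp: tm_space)
      have "take w (drop r (subst_word thue_morse ?u)) = seq_factor (bisubst thue_morse x) (2 * i + a) w"
        "take w (drop (r + 1) (subst_word thue_morse ?u)) = seq_factor (bisubst thue_morse x) (2 * i + 1 + a) w"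
        unfolding u using w'[folded r_def] abr by (subst take_drop_seq_factor; simp add: algebra_simps)+
      then show ?thesis by (simp add: block_def \<phi>'_def)
    qed
    have F'0: "?F' x0 = z"
    proof
      fix i
      have "[bisubst \<beta> z (2 * i), bisubst \<beta> z (2 * i + 1)] = \<beta> (z i)"
        using image_eq[OF value_in[OF z, of i]] by (simp add: bisubst_def)
      then show "?F' x0 i = z i"
        unfolding F'[OF x0] block0 using inv_into_f_f[OF inj value_in[OF z]] by simp
    qed
    \<comment> \<open>Both claims are known at \<open>x0\<close>, where the new code returns
      \<open>z\<close>. They pass to \<open>x\<close> because each concerns a finite window, and
      that window also occurs in \<open>x0\<close>.\<close>
    have rel: "block \<phi> a w (bisubst thue_morse x) = bisubst \<beta> (?F' x)" and F'A: "?F' x \<in> ?Y" if x: "x \<in> ?X" for x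
    proof -
      show "?F' x \<in> ?Y"
      proof (rule subst_spaceI)
        fix i n
        obtain j where "seq_factor x0 j (n + w') = seq_factor x (i + b) (n + w')"
          using tm_occurs[OF x x0] by blast
        then have "seq_factor (?F' x) i n = seq_factor (?F' x0) (j - b) n"
          by (intro seq_factor_block_cong) simp
        then show "seq_factor (?F' x) i n \<in> language A \<beta>"
          using F'0 factor_language[OF z] by simp
      qed
      show "block \<phi> a w (bisubst thue_morse x) = bisubst \<beta> (?F' x)"
      proof
        fix i :: int
        define q where "q = i div 2"
        let ?G = "\<lambda>x. block \<phi> a w (bisubst thue_morse x)"
        obtain j where j: "seq_factor x0 j w' = seq_factor x (q + b) w'"
          using tm_occurs[OF x x0] by blast
        have set_u: "set (seq_factor v p w') \<subseteq> {0, 1}" if "v \<in> ?X" for v p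
          using set_seq_factor[of v p w'] tm.range_subset[of v] that by (auto simp: tm_space)
        have u: "seq_factor (bisubst thue_morse v) (2 * p) (2 * w') = subst_word thue_morse (seq_factor v p w')"
          if "v \<in> ?X" for v p
          using tm.seq_factor_bisubst[of v "2 * p" "2 * w'" w'] tm.range_subset[of v] that
            tm.length_subst_word[OF set_u[OF that]] by (auto simp: tm_space)
        have eq6: "seq_factor (bisubst thue_morse x) (2 * (q + b)) (2 * w') = seq_factor (bisubst thue_morse x0) (2 * j) (2 * w')"
          unfolding u[OF x] u[OF x0] j ..
        have Gq: "?G x (2 * q + int l) = ?G x0 (2 * (j - b) + int l)" if "l < 2" for l
        proof -
          have "seq_factor (bisubst thue_morse x) (2 * (q + b) + int (l + r)) w
            = seq_factor (bisubst thue_morse x0) (2 * j + int (l + r)) w"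
            using w'[folded r_def] that by (intro seq_factor_mono_cong[OF eq6]) auto
          then show ?thesis unfolding block_def abr by (simp add: algebra_simps)
        qed
        have pair: "[?G x (2 * q), ?G x (2 * q + 1)] = \<beta> (z (j - b))"
          using Gq[of 0] Gq[of 1] image_eq[OF value_in[OF z, of "j - b"]]
            bisubst_double[of \<beta> z "j - b"]
          unfolding block0 by simp
        have "?F' x q = z (j - b)"
          unfolding F'[OF x] pair by (rule inv_into_f_f[OF inj value_in[OF z]])
        then have "bisubst \<beta> (?F' x) (2 * q) = ?G x (2 * q)" "bisubst \<beta> (?F' x) (2 * q + 1) = ?G x (2 * q + 1)"
          unfolding bisubst_double by (simp_all flip: pair)
        moreover have "i = 2 * q \<or> i = 2 * q + 1" unfolding q_def by presburger
        ultimately show "?G x i = bisubst \<beta> (?F' x) i" by metis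
      qed
    qed
    have "inj_on ?F' ?X"
    proof (rule inj_onI)
      fix x x' assume x: "x \<in> ?X" "x' \<in> ?X" "?F' x = ?F' x'"
      then have "block \<phi> a w (bisubst thue_morse x) = block \<phi> a w (bisubst thue_morse x')"
        using rel by simp
      then have "bisubst thue_morse x = bisubst thue_morse x'"
        using embeds_offset[OF emb, of a] tm_bisubst x(1,2) by (auto simp: embeds_def inj_on_def)
      then show "x = x'"
        using tm.bisubst_inj[OF tm.range_subset tm.range_subset, of x x'] x(1,2) by (simp add: tm_space)
    qed
    then show "\<exists>\<phi>'. embeds (block \<phi>' (a div 2) w') \<and>
      (\<forall>x\<in>?X. block \<phi> a w (bisubst thue_morse x) = bisubst \<beta> (block \<phi>' (a div 2) w' x))"
      unfolding b_def[symmetric] embeds_def using rel F'A by blast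
  qed
qed

text \<open>In the worse parity the new width w' must satisfy w + 2 <= 2w'. The choice w' = w - 1
  meets this exactly from w = 4 on, so the descent ends at width three; decreasing by one is enough
  for the induction.\<close>

lemma embeds_narrow:
  assumes "embeds (block \<phi> 0 w)"
  shows "\<exists>\<phi>'. embeds (block \<phi>' 0 3)"
  using assms
proof (induction w arbitrary: \<phi> rule: less_induct)
  case (less w)
  show ?case
  proof (cases "w \<le> 3")
    case True
    then obtain \<psi> where "block \<psi> 0 3 = block \<phi> 0 w" using block_pad[of 0 0 w 3 \<phi>] by auto
    then show ?thesis using less.prems by metis
  next
    case False
    obtain k where k: "\<And>a w'. a mod 2 = k mod 2 \<Longrightarrow> nat (a mod 2) + w + 1 \<le> 2 * w' \<Longrightarrow>
      \<exists>\<phi>'. embeds (block \<phi>' (a div 2) w') \<and>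
        (\<forall>x\<in>thue_morse_space. block \<phi> a w (bisubst thue_morse x) = bisubst \<beta> (block \<phi>' (a div 2) w' x))"
      using renormalize[OF less.prems] by blast
    have "nat (k mod 2) \<le> 1" by auto
    then have "nat (k mod 2) + w + 1 \<le> 2 * (w - 1)" using False by linarith
    then obtain \<phi>' where "embeds (block \<phi>' (k div 2) (w - 1))" using k[of k "w - 1"] by auto
    then show ?thesis using less.IH[of "w - 1", OF _ embeds_offset] False by auto
  qed
qed

text \<open>The integers 0 and -1 are fixed by \<open>div 2\<close>, one for each parity, so the two
  codes of a pair can share their offset. At width three the odd parity keeps the width, while the
  even parity lowers it to two, and width two is kept by both parities. All resulting windows fit
  into the positions -1, 0, 1.\<close>

lemma renormalized_pair:
  assumes "embeds (block \<phi> a w)"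
  obtains \<phi>\<^sub>1 \<phi>\<^sub>2 where "embeds (block \<phi>\<^sub>1 (- 1) 3)" "embeds (block \<phi>\<^sub>2 (- 1) 3)"
    "\<And>x. x \<in> thue_morse_space \<Longrightarrow> block \<phi>\<^sub>1 (- 1) 3 (bisubst thue_morse x) = bisubst \<beta> (block \<phi>\<^sub>2 (- 1) 3 x)"
proof -
  let ?pair = "\<lambda>F G. embeds F \<and> embeds G \<and>
    (\<forall>x\<in>thue_morse_space. F (bisubst thue_morse x) = bisubst \<beta> (G x))"
  have two: "\<exists>\<phi>\<^sub>1 \<phi>\<^sub>2. ?pair (block \<phi>\<^sub>1 (- 1) 3) (block \<phi>\<^sub>2 (- 1) 3)" if emb: "embeds (block \<psi> 0 2)" for \<psi>
  proof -
    obtain k where k: "\<And>a w'. a mod 2 = k mod 2 \<Longrightarrow> nat (a mod 2) + 2 + 1 \<le> 2 * w' \<Longrightarrow>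
      \<exists>\<phi>'. embeds (block \<phi>' (a div 2) w') \<and>
        (\<forall>x\<in>thue_morse_space. block \<psi> a 2 (bisubst thue_morse x) = bisubst \<beta> (block \<phi>' (a div 2) w' x))"
      using renormalize[OF emb] by blast
    obtain a :: int where a: "a = 0 \<or> a = - 1" "a mod 2 = k mod 2"
    proof (cases "k mod 2 = 0")
      case True then show thesis using that[of 0] by simp
    next
      case False then show thesis using that[of "- 1"] by simp
    qed
    have d: "a div 2 = a" using a(1) by auto
    obtain \<phi>' where "?pair (block \<psi> a 2) (block \<phi>' a 2)"
      using k[OF a(2), of 2, unfolded d] embeds_offset[OF emb] a(1) by fastforce
    moreover obtain \<phi>\<^sub>1 where "block \<phi>\<^sub>1 (- 1) 3 = block \<psi> a 2"
      using block_pad[of "- 1" a 2 3 \<psi>] a(1) by auto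
    moreover obtain \<phi>\<^sub>2 where "block \<phi>\<^sub>2 (- 1) 3 = block \<phi>' a 2"
      using block_pad[of "- 1" a 2 3 \<phi>'] a(1) by auto
    ultimately show ?thesis by metis
  qed
  obtain \<psi> where emb: "embeds (block \<psi> 0 3)"
    using embeds_narrow[OF embeds_offset[OF assms]] by blast
  obtain k where k: "\<And>a w'. a mod 2 = k mod 2 \<Longrightarrow> nat (a mod 2) + 3 + 1 \<le> 2 * w' \<Longrightarrow>
    \<exists>\<phi>'. embeds (block \<phi>' (a div 2) w') \<and>
      (\<forall>x\<in>thue_morse_space. block \<psi> a 3 (bisubst thue_morse x) = bisubst \<beta> (block \<phi>' (a div 2) w' x))"
    using renormalize[OF emb] by blast
  have "\<exists>\<phi>\<^sub>1 \<phi>\<^sub>2. ?pair (block \<phi>\<^sub>1 (- 1) 3) (block \<phi>\<^sub>2 (- 1) 3)"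
  proof (cases "k mod 2 = 0")
    case True
    then obtain \<phi>' where "embeds (block \<phi>' 0 2)" using k[of 0 2] by auto
    then show ?thesis by (rule two)
  next
    case False
    then have "(- 1) mod 2 = k mod 2" by simp
    then obtain \<phi>' where "?pair (block \<psi> (- 1) 3) (block \<phi>' (- 1) 3)"
      using k[of "- 1" 3] embeds_offset[OF emb] by auto
    then show ?thesis by blast
  qed
  then show thesis using that by blast
qed

section \<open>Finite constraints on three-letter labellings\<close>

lemma embedding_covers_language:
  assumes "embeds (block \<phi> a w)" "v \<in> language A \<beta>" "x \<in> thue_morse_space"
  shows "\<exists>i. seq_factor (block \<phi> a w x) i (length v) = v"
  using assms language_occurs[of "block \<phi> a w x" v] by (auto simp: embeds_def)

lemma tm_word_occurs:
  assumes "u \<in> language {0, 1} thue_morse" "x \<in> thue_morse_space"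
  shows "\<exists>i. seq_factor x i (length u) = u"
  using tm.language_occurs assms unfolding tm_space by blast

lemma embedding_image:
  assumes emb: "embeds (block \<phi> (- 1) 3)"
  shows "\<phi> ` set tm3 = A"
proof -
  obtain x where x: "x \<in> thue_morse_space" using thue_morse_space_nonempty by blast
  have Fx: "block \<phi> (- 1) 3 x \<in> subst_space A \<beta>" using emb x by (auto simp: embeds_def)
  show ?thesis
  proof (intro equalityI subsetI)
    fix a assume "a \<in> \<phi> ` set tm3"
    then obtain u where u: "u \<in> set tm3" "a = \<phi> u" by blast
    have "length u = 3" using u(1) by (auto simp: tm3_def)
    then obtain i where "seq_factor x i 3 = u" using tm_word_occurs[OF tm3_language[OF u(1)] x] by auto
    then have "a = block \<phi> (- 1) 3 x (i + 1)" by (simp add: block_def u(2))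
    then show "a \<in> A" using value_in[OF Fx] by simp
  next
    fix a assume "a \<in> A"
    then obtain i where "seq_factor (block \<phi> (- 1) 3 x) i 1 = [a]"
      using embedding_covers_language[OF emb singleton_language x] by fastforce
    then have "a = \<phi> (seq_factor x (i + - 1) 3)" by (simp add: seq_factor_def block_def)
    then show "a \<in> \<phi> ` set tm3" using tm_factor3[OF x] by blast
  qed
qed

text \<open>The right-hand side does not depend on \<open>\<phi>\<close>. Comparing two embeddings
  through it shows that their labellings have the same set of adjacent labels.\<close>

lemma embedding_two_words:
  assumes emb: "embeds (block \<phi> (- 1) 3)"
  shows "(\<lambda>u. [\<phi> (take 3 u), \<phi> (drop 1 u)]) ` set tm4 = {v \<in> language A \<beta>. length v = 2}"
proof -
  obtain x where x: "x \<in> thue_morse_space" using thue_morse_space_nonempty by blast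
  have Fx: "block \<phi> (- 1) 3 x \<in> subst_space A \<beta>" using emb x by (auto simp: embeds_def)
  have *: "seq_factor (block \<phi> (- 1) 3 x) i 2
      = [\<phi> (take 3 (seq_factor x (i - 1) 4)), \<phi> (drop 1 (seq_factor x (i - 1) 4))]" for i
    using take_drop_seq_factor[of 1 3 4 x "i - 1"] take_drop_seq_factor[of 0 3 4 x "i - 1"]
    by (simp add: seq_factor_2 block_def)
  show ?thesis
  proof (intro equalityI subsetI)
    fix v assume "v \<in> (\<lambda>u. [\<phi> (take 3 u), \<phi> (drop 1 u)]) ` set tm4"
    then obtain u where u: "u \<in> set tm4" "v = [\<phi> (take 3 u), \<phi> (drop 1 u)]" by blast
    have "length u = 4" using u(1) by (auto simp: tm4_def)
    then obtain i where "seq_factor x i 4 = u" using tm_word_occurs[OF tm4_language[OF u(1)] x] by auto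
    then have "v = seq_factor (block \<phi> (- 1) 3 x) (i + 1) 2" using *[of "i + 1"] u(2) by simp
    then show "v \<in> {v \<in> language A \<beta>. length v = 2}" using factor_language[OF Fx] by simp
  next
    fix v assume v: "v \<in> {v \<in> language A \<beta>. length v = 2}"
    then obtain i where "seq_factor (block \<phi> (- 1) 3 x) i 2 = v"
      using embedding_covers_language[OF emb _ x, of v] by auto
    then show "v \<in> (\<lambda>u. [\<phi> (take 3 u), \<phi> (drop 1 u)]) ` set tm4"
      using tm_factor4[OF x] * by blast
  qed
qed

text \<open>Otherwise a point and its complement, which are distinct and both in the Thue-Morse
  system, would have the same image.\<close>

lemma embedding_not_flip_invariant:
  assumes emb: "embeds (block \<phi> (- 1) 3)"
  shows "\<exists>u\<in>set tm3. \<phi> (map flip u) \<noteq> \<phi> u"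
proof (rule ccontr)
  assume "\<not> (\<exists>u\<in>set tm3. \<phi> (map flip u) \<noteq> \<phi> u)"
  then have inv: "\<phi> (map flip u) = \<phi> u" if "u \<in> set tm3" for u using that by blast
  obtain x where x: "x \<in> thue_morse_space" using thue_morse_space_nonempty by blast
  let ?x' = "\<lambda>i. flip (x i)"
  have "seq_factor ?x' i n = map flip (seq_factor x i n)" for i n
    by (simp add: seq_factor_def)
  then have "block \<phi> (- 1) 3 ?x' = block \<phi> (- 1) 3 x"
    using inv tm_factor3[OF x] by (auto simp: block_def)
  then have "?x' = x"
    using emb x flip_in_space[OF x] by (auto simp: embeds_def inj_on_def)
  then have "flip (x 0) = x 0" by metis
  then show False using tm_value[OF x, of 0] by auto
qed

text \<open>Every word of \<open>tm3\<close> occurs in a point, so the equation between codes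
  becomes six equations between labels. By \<open>embedding_image\<close> the labels on the left
  exhaust the alphabet, so these equations determine \<beta>.\<close>

lemma pair_on_words:
  assumes rel: "\<And>x. x \<in> thue_morse_space \<Longrightarrow>
      block \<phi>\<^sub>1 (- 1) 3 (bisubst thue_morse x) = bisubst \<beta> (block \<phi>\<^sub>2 (- 1) 3 x)"
    and emb: "embeds (block \<phi>\<^sub>2 (- 1) 3)" and u: "u \<in> set tm3"
  shows "\<beta> (\<phi>\<^sub>2 u) = [\<phi>\<^sub>1 (take 3 (drop 1 (subst_word thue_morse u))), \<phi>\<^sub>1 (take 3 (drop 2 (subst_word thue_morse u)))]"
proof -
  obtain x where x: "x \<in> thue_morse_space" using thue_morse_space_nonempty by blast
  have "length u = 3" using u by (auto simp: tm3_def)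
  then obtain i where i: "seq_factor x i 3 = u" using tm_word_occurs[OF tm3_language[OF u] x] by auto
  have \<phi>\<^sub>2: "\<phi>\<^sub>2 u = block \<phi>\<^sub>2 (- 1) 3 x (i + 1)" by (simp add: block_def i)
  have w: "subst_word thue_morse u = seq_factor (bisubst thue_morse x) (2 * i) 6"
    using tm.seq_factor_bisubst[of x "2 * i" 6 3] x tm.range_subset[of x]
      tm.length_subst_word[of u] set_seq_factor[of x i 3] i
    by (auto simp: tm_space)
  have "\<phi>\<^sub>1 (take 3 (drop (k + 1) (subst_word thue_morse u)))
      = block \<phi>\<^sub>1 (- 1) 3 (bisubst thue_morse x) (2 * (i + 1) + int k)" if "k < 2" for k
    unfolding w block_def using that by (subst take_drop_seq_factor) (auto simp: algebra_simps)
  then have "\<phi>\<^sub>1 (take 3 (drop (k + 1) (subst_word thue_morse u)))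
      = bisubst \<beta> (block \<phi>\<^sub>2 (- 1) 3 x) (2 * (i + 1) + int k)" if "k < 2" for k
    unfolding rel[OF x, symmetric] using that .
  from this[of 0] this[of 1]
  have "\<phi>\<^sub>1 (take 3 (drop 1 (subst_word thue_morse u))) = \<beta> (\<phi>\<^sub>2 u) ! 0"
    "\<phi>\<^sub>1 (take 3 (drop 2 (subst_word thue_morse u))) = \<beta> (\<phi>\<^sub>2 u) ! 1"
    unfolding \<phi>\<^sub>2 by (simp_all add: bisubst_def numeral_2_eq_2)
  moreover have "\<phi>\<^sub>2 u \<in> A" using embedding_image[OF emb] u by blast
  ultimately show ?thesis using image_eq by simp
qed

lemma no_doubled_letter:
  assumes "a \<in> A" shows "\<beta> a \<noteq> [a, a]"
proof
  assume a: "\<beta> a = [a, a]"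
  have "set (subst_word \<beta> w) \<subseteq> {a}" if "set w \<subseteq> {a}" for w
    using that a by (auto simp: subst_word_def)
  then have "set (subst_pow \<beta> n a) \<subseteq> {a}" for n
    by (induction n) (auto simp: subst_pow_Suc)
  then have "A \<subseteq> {a}" using primitive assms unfolding primitive_def by blast
  then have "card A \<le> 1" using card_mono[of "{a}" A] by simp
  then show False using substitution by (simp add: substitution_def)
qed

text \<open>The homeomorphism in the hypothesis starts from the system of \<beta>; the block code
  comes from its inverse, which inherits commutation with the shift.\<close>

lemma embedding_exists:
  assumes "topologically_conjugate A (subst_space A \<beta>) {0, 1} thue_morse_space"
  shows "\<exists>\<phi> a w. embeds (block \<phi> a w)"
proof -
  let ?Y = "subst_space A \<beta>" and ?X = thue_morse_space
  let ?TY = "shift_topology A ?Y" and ?TX = "shift_topology {0, 1} ?X"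
  obtain h where h: "homeomorphic_map ?TY ?TX h" and comm: "\<And>y. y \<in> ?Y \<Longrightarrow> h (left_shift y) = left_shift (h y)"
    using assms unfolding topologically_conjugate_def by blast
  obtain g where g: "homeomorphic_maps ?TY ?TX h g" using h homeomorphic_map_maps by blast
  have topY: "topspace ?TY = ?Y" by (rule topspace_shift_topology) (rule range_subset)
  have topX: "topspace ?TX = ?X" by (rule topspace_shift_topology) (use tm.range_subset tm_space in auto)
  have gh: "\<And>y. y \<in> ?Y \<Longrightarrow> g (h y) = y" and hg: "\<And>x. x \<in> ?X \<Longrightarrow> h (g x) = x"
    and contg: "continuous_map ?TX ?TY g"
    using g unfolding homeomorphic_maps_def topX topY by auto
  have gY: "g x \<in> ?Y" if "x \<in> ?X" for x
    using continuous_map_funspace[OF contg] that unfolding topX topY by auto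
  have "g (left_shift x) = left_shift (g x)" if x: "x \<in> ?X" for x
  proof -
    have "left_shift (g x) \<in> ?Y" unfolding left_shift_eq by (rule shift_in_space[OF gY[OF x]])
    then show ?thesis using comm[OF gY[OF x]] gh hg[OF x] by metis
  qed
  then obtain \<phi> a w where \<phi>: "\<forall>x\<in>?X. g x = block \<phi> a w x"
    using tm.curtis_hedlund_lyndon[of A ?Y g] contg range_subset unfolding tm_space by blast
  then have "embeds (block \<phi> a w)"
    unfolding embeds_def using gY hg by (metis (no_types, lifting) image_subsetI inj_onI)
  then show ?thesis by blast
qed

end

section \<open>Search over labellings\<close>

fun restricted_growth :: "nat \<Rightarrow> nat list \<Rightarrow> bool" where
  "restricted_growth m [] \<longleftrightarrow> True"
| "restricted_growth m (x # xs) \<longleftrightarrow> x \<le> m \<and> restricted_growth (max m (Suc x)) xs"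

fun growth_lists :: "nat \<Rightarrow> nat \<Rightarrow> nat list list" where
  "growth_lists 0 m = [[]]"
| "growth_lists (Suc n) m = concat (map (\<lambda>x. map ((#) x) (growth_lists n (max m (Suc x)))) [0..<Suc m])"

lemma restricted_growth_listed: "restricted_growth m xs \<Longrightarrow> xs \<in> set (growth_lists (length xs) m)"
  by (induction m xs rule: restricted_growth.induct) (auto simp: less_Suc_eq_le simp del: upt_Suc)

text \<open>Letters are numbered in the order of first appearance; \<open>D\<close> holds those
  numbered so far, and the next new letter receives \<open>m\<close>.\<close>

lemma exists_coding_extension:
  assumes "inj_on c D" "c ` D = {0..<m}"
  shows "\<exists>c'. (\<forall>d\<in>D. c' d = c d) \<and> inj_on c' (D \<union> set xs) \<and> restricted_growth m (map c' xs)"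
  using assms
proof (induction xs arbitrary: D c m)
  case (Cons x xs)
  show ?case
  proof (cases "x \<in> D")
    case True
    then have "c x < m" using Cons.prems by auto
    obtain c' where c': "\<forall>d\<in>D. c' d = c d" "inj_on c' (D \<union> set xs)" "restricted_growth m (map c' xs)"
      using Cons.IH[OF Cons.prems] by blast
    moreover have "max m (Suc (c x)) = m" using \<open>c x < m\<close> by simp
    ultimately show ?thesis using True \<open>c x < m\<close>
      by (intro exI[of _ c']) (auto simp: insert_absorb)
  next
    case False
    let ?c = "c(x := m)"
    have "?c ` insert x D = insert m (c ` D)" using False by auto
    then have im: "?c ` insert x D = {0..<Suc m}" using Cons.prems(2) by (simp add: atLeast0_lessThan_Suc)
    have "m \<notin> c ` D" unfolding Cons.prems(2) by simp
    then have "inj_on ?c (insert x D)" using Cons.prems(1) False by (auto simp: inj_on_def)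
    then obtain c' where c': "\<forall>d\<in>insert x D. c' d = ?c d" "inj_on c' (insert x D \<union> set xs)"
      "restricted_growth (Suc m) (map c' xs)"
      using Cons.IH[of ?c "insert x D" "Suc m"] im by blast
    moreover have "\<forall>d\<in>D. c' d = c d" "c' x = m" using c'(1) False by auto
    ultimately show ?thesis by (intro exI[of _ c']) auto
  qed
qed auto

lemma exists_coding: "\<exists>c. inj_on c (set xs) \<and> restricted_growth 0 (map c xs)"
  using exists_coding_extension[of "\<lambda>_. 0" "{}" 0 xs] by auto

fun prefix_search :: "('b list \<Rightarrow> bool) \<Rightarrow> 'b list \<Rightarrow> nat \<Rightarrow> 'b list \<Rightarrow> 'b list list" where
  "prefix_search ok cs 0 acc = [acc]"
| "prefix_search ok cs (Suc n) acc =
    concat (map (\<lambda>c. if ok (acc @ [c]) then prefix_search ok cs n (acc @ [c]) else []) cs)"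

text \<open>What matters is that pruning loses nothing: a list whose nonempty prefixes all pass
  \<open>ok\<close> survives, whatever else is returned.\<close>

lemma prefix_search_complete:
  assumes "\<And>m. m < length G \<Longrightarrow> ok (take (Suc m) G)" "set G \<subseteq> set cs" "n \<le> length G"
  shows "G \<in> set (prefix_search ok cs n (take (length G - n) G))"
  using assms(3)
proof (induction n)
  case (Suc n)
  let ?m = "length G - Suc n"
  have m: "?m < length G" "Suc ?m = length G - n" using Suc.prems by auto
  have "G ! ?m \<in> set cs" using assms(2) m(1) nth_mem by blast
  moreover have "take ?m G @ [G ! ?m] = take (length G - n) G"
    using m by (metis take_Suc_conv_app_nth)
  moreover have "ok (take (length G - n) G)" using assms(1)[OF m(1)] m(2) by simp
  ultimately show ?case using Suc by (auto intro!: bexI[of _ "G ! ?m"])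
qed simp

text \<open>A three-block labelling is stored as the list of its values on \<open>tm3\<close>.  The lists
  \<open>doubling_pairs\<close> and \<open>overlap_edges\<close> give the positions in \<open>tm3\<close> of the two
  inner three-letter factors of a substituted word and of the two factors of a four-letter word.\<close>

definition doubling_pairs :: "(nat \<times> nat) list" where
  "doubling_pairs = [(4,2), (5,3), (5,4), (0,1), (0,2), (1,3)]"

definition overlap_edges :: "(nat \<times> nat) list" where
  "overlap_edges = [(0,1), (0,2), (1,3), (1,4), (2,5), (3,0), (4,1), (4,2), (5,3), (5,4)]"

definition pairs_at :: "(nat \<times> nat) list \<Rightarrow> 'b list \<Rightarrow> ('b \<times> 'b) list" where
  "pairs_at is xs = map (\<lambda>(i, j). (xs ! i, xs ! j)) is"

text \<open>Entry i of \<open>P\<close> is the intended \<beta>-image of entry i of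
  \<open>acc\<close>, so matching equalities mean that \<beta> is well defined and injective on the
  entries so far. Only conditions whose larger index is the newest position are tested; the others
  were tested on shorter prefixes.\<close>

definition prefix_ok :: "('b \<times> 'b) list \<Rightarrow> ('b \<times> 'b) list \<Rightarrow> 'b list \<Rightarrow> bool" where
  "prefix_ok P W acc \<longleftrightarrow> (let i = length acc - 1; c = acc ! i in
     list_all (\<lambda>j. (acc ! j = c) = (P ! j = P ! i)) [0..<i] \<and>
     list_all (\<lambda>(a, b). max a b = i \<longrightarrow> (acc ! a, acc ! b) \<in> set W) overlap_edges)"

text \<open>\<beta> must map the letters bijectively onto the pairs in \<open>P\<close>, which gives
  a count test before any search, and \<open>F = rev F\<close> is invariance under complementation.
  The final filter holds conditions that need the complete list, such as each letter and each edge
  of \<open>F\<close> being hit.\<close>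

definition labelling_candidates :: "nat list \<Rightarrow> nat list list" where
  "labelling_candidates F = (let P = pairs_at doubling_pairs F; W = pairs_at overlap_edges F; cs = remdups F in
     if F = rev F \<or> length (remdups P) \<noteq> length cs then []
     else filter (\<lambda>G. set W \<subseteq> set (pairs_at overlap_edges G) \<and> set F \<subseteq> set G \<and>
            list_all (\<lambda>i. P ! i \<noteq> (G ! i, G ! i)) [0..<6])
       (prefix_search (prefix_ok P W) cs 6 []))"

text \<open>The entry \<open>s ! n\<close> is the table letter for the code \<open>n\<close>. Codes
  follow first appearance in \<open>F\<close>, so different labellings can number the letters of one
  table differently; four tables are listed with two renamings.\<close>

definition table_renamings :: "(nat list list \<times> nat list) list" where
  "table_renamings = map (\<lambda>(n, s). (twelve_tables ! n, s))
    [(0, [1,2]), (1, [1,2]), (2, [1,2,3]), (2, [3,1,2]), (3, [1,2,3]), (3, [2,1,3]),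
     (4, [1,3,2,4]), (5, [1,2,4,3]), (6, [2,1,3,4]), (7, [2,3,1,4]),
     (8, [1,4,2,5,3]), (8, [3,1,5,2,4]), (9, [2,1,3,5,4]), (9, [4,5,3,1,2]),
     (10, [2,1,3,4,6,5]), (11, [2,5,3,6,1,4])]"

definition renames_to :: "nat list \<Rightarrow> nat list \<Rightarrow> nat list list \<Rightarrow> nat list \<Rightarrow> bool" where
  "renames_to F G t s \<longleftrightarrow> length s = length t \<and> distinct s \<and> set s = {1..length t} \<and> set F = {0..<length t} \<and>
     list_all (\<lambda>i. t ! (s ! (G ! i) - 1) =
       [s ! fst (pairs_at doubling_pairs F ! i), s ! snd (pairs_at doubling_pairs F ! i)]) [0..<6]"

lemma all_candidates_rename:
  "list_all (\<lambda>F. list_all (\<lambda>G. list_ex (\<lambda>(t, s). renames_to F G t s) table_renamings)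
     (labelling_candidates F)) (growth_lists 6 0)"
  by code_simp

lemma pairs_at_map:
  "\<forall>(i, j)\<in>set is. i < length xs \<and> j < length xs \<Longrightarrow>
    pairs_at is (map f xs) = map (map_prod f f) (pairs_at is xs)"
  by (auto simp: pairs_at_def)

text \<open>Injectivity of \<open>B\<close> makes the equality patterns of \<open>G\<close> and of
  its image pairs agree, so every prefix of \<open>G\<close> passes the test and the evaluated
  search must have met \<open>G\<close>.\<close>

lemma labelling_search:
  assumes len: "length F = 6" "length G = 6" and growth: "restricted_growth 0 F"
    and same: "set G = set F"
    and doubling: "pairs_at doubling_pairs F = map B G" and B: "inj_on B (set G)"
    and edges: "set (pairs_at overlap_edges F) = set (pairs_at overlap_edges G)"
    and not_flip: "F \<noteq> rev F"
    and not_doubled: "\<And>i. i < 6 \<Longrightarrow> pairs_at doubling_pairs F ! i \<noteq> (G ! i, G ! i)"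
  shows "\<exists>(t, s)\<in>set table_renamings. renames_to F G t s"
proof -
  define P where "P = pairs_at doubling_pairs F"
  define W where "W = pairs_at overlap_edges F"
  have P: "P ! i = B (G ! i)" if "i < 6" for i
    unfolding P_def doubling using that len by simp
  have "card (set P) = card (set F)"
    unfolding P_def doubling using B same by (simp add: card_image)
  then have count: "length (remdups P) = length (remdups F)"
    by (simp add: length_remdups_card_conv)
  have "G \<in> set (prefix_search (prefix_ok P W) (remdups F) (length G) (take (length G - length G) G))"
  proof (rule prefix_search_complete)
    fix m assume m: "m < length G"
    have edge: "(G ! a, G ! b) \<in> set W" if "(a, b) \<in> set overlap_edges" for a b
      unfolding W_def edges using that by (force simp: pairs_at_def)
    have "(G ! j = G ! m) = (P ! j = P ! m)" if "j < m" for j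
      using P m that len inj_on_eq_iff[OF B, of "G ! j" "G ! m"] by simp
    then show "prefix_ok P W (take (Suc m) G)"
      unfolding prefix_ok_def using m edge by (auto simp: list_all_iff Let_def)
  qed (use same in auto)
  then have "G \<in> set (labelling_candidates F)"
    using count not_flip not_doubled edges same len
    by (simp add: labelling_candidates_def Let_def P_def W_def list_all_iff)
  moreover have "F \<in> set (growth_lists 6 0)"
    using restricted_growth_listed[OF growth] len by simp
  ultimately show ?thesis
    using all_candidates_rename by (auto simp: list_all_iff list_ex_iff)
qed

section \<open>From a pair of labellings to a renaming of a table\<close>

context doubling
begin

lemma renaming_of_pair:
  assumes emb: "embeds (block \<phi>\<^sub>1 (- 1) 3)" "embeds (block \<phi>\<^sub>2 (- 1) 3)"
    and rel: "\<And>x. x \<in> thue_morse_space \<Longrightarrow>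
      block \<phi>\<^sub>1 (- 1) 3 (bisubst thue_morse x) = bisubst \<beta> (block \<phi>\<^sub>2 (- 1) 3 x)"
  shows "\<exists>t\<in>set twelve_tables. same_up_to_renaming A \<beta> (table_alphabet t) (table_subst t)"
proof -
  define fs where "fs = map \<phi>\<^sub>1 tm3"
  define gs where "gs = map \<phi>\<^sub>2 tm3"
  have len: "length fs = 6" "length gs = 6" by (simp_all add: fs_def gs_def tm3_def)
  have fsA: "set fs = A" and gsA: "set gs = A"
    using embedding_image[OF emb(1)] embedding_image[OF emb(2)] by (simp_all add: fs_def gs_def)
  have doubled: "pairs_at doubling_pairs fs = map (\<lambda>a. (\<beta> a ! 0, \<beta> a ! 1)) gs"
  proof -
    have "map (\<lambda>a. (\<beta> a ! 0, \<beta> a ! 1)) gs = map (\<lambda>u. (\<phi>\<^sub>1 (take 3 (drop 1 (subst_word thue_morse u))),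
        \<phi>\<^sub>1 (take 3 (drop 2 (subst_word thue_morse u))))) tm3"
      using pair_on_words[OF rel emb(2)] by (simp add: gs_def)
    also have "\<dots> = pairs_at doubling_pairs fs"
      by (simp add: fs_def tm3_def pairs_at_def doubling_pairs_def subst_word_def thue_morse_def)
    finally show ?thesis ..
  qed
  have edges4: "pairs_at overlap_edges (map \<phi> tm3) = map (\<lambda>u. (\<phi> (take 3 u), \<phi> (drop 1 u))) tm4"
    for \<phi> :: "nat list \<Rightarrow> 'a"
    by (simp add: tm3_def tm4_def pairs_at_def overlap_edges_def)
  have "(\<lambda>u. [\<phi>\<^sub>1 (take 3 u), \<phi>\<^sub>1 (drop 1 u)]) ` set tm4 = (\<lambda>u. [\<phi>\<^sub>2 (take 3 u), \<phi>\<^sub>2 (drop 1 u)]) ` set tm4"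
    using embedding_two_words[OF emb(1)] embedding_two_words[OF emb(2)] by simp
  then have "(\<lambda>v. (v ! 0, v ! 1)) ` (\<lambda>u. [\<phi>\<^sub>1 (take 3 u), \<phi>\<^sub>1 (drop 1 u)]) ` set tm4
      = (\<lambda>v. (v ! 0, v ! 1)) ` (\<lambda>u. [\<phi>\<^sub>2 (take 3 u), \<phi>\<^sub>2 (drop 1 u)]) ` set tm4"
    by simp
  then have edges: "set (pairs_at overlap_edges fs) = set (pairs_at overlap_edges gs)"
    unfolding fs_def gs_def edges4 by (simp add: image_image)
  have not_flip: "fs \<noteq> rev fs"
  proof
    assume "fs = rev fs"
    also have "rev fs = map (\<lambda>u. \<phi>\<^sub>1 (map flip u)) tm3"
      by (simp add: fs_def tm3_def)
    finally have "\<forall>u\<in>set tm3. \<phi>\<^sub>1 (map flip u) = \<phi>\<^sub>1 u" by (simp add: fs_def)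
    then show False using embedding_not_flip_invariant[OF emb(1)] by blast
  qed
  have valid: "\<forall>(i, j)\<in>set doubling_pairs. i < 6 \<and> j < 6" "\<forall>(i, j)\<in>set overlap_edges. i < 6 \<and> j < 6"
    by (auto simp: doubling_pairs_def overlap_edges_def)
  \<comment> \<open>The letters are coded by their first appearance in \<open>fs\<close>; the same
    coding is then applied to \<open>gs\<close>, so that both lists become the natural-number lists
    of the search.\<close>
  obtain c where c: "inj_on c A" "restricted_growth 0 (map c fs)"
    using exists_coding[of fs] fsA by auto
  \<comment> \<open>This is \<beta> transported to codes, with its two-letter value written as a
    pair.\<close>
  define B where "B n = map_prod c c (let a = inv_into A c n in (\<beta> a ! 0, \<beta> a ! 1))" for n
  have B: "B (c a) = (c (\<beta> a ! 0), c (\<beta> a ! 1))" if "a \<in> A" for a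
    using inv_into_f_f[OF c(1) that] by (simp add: B_def)
  have pairs: "pairs_at doubling_pairs (map c fs) = map B (map c gs)"
    using valid(1) len gsA B by (simp add: pairs_at_map doubled)
  have "inj_on B (set (map c gs))"
  proof (rule inj_onI)
    fix m n assume "m \<in> set (map c gs)" "n \<in> set (map c gs)" and eq: "B m = B n"
    then obtain a b where ab: "a \<in> A" "b \<in> A" "m = c a" "n = c b" using gsA by auto
    have "\<beta> a ! 0 = \<beta> b ! 0" "\<beta> a ! 1 = \<beta> b ! 1"
      using eq ab B nth_image_in inj_on_eq_iff[OF c(1)] by auto
    then have "\<beta> a = \<beta> b" using image_eq ab by metis
    then show "m = n" using inj ab by (simp add: inj_on_eq_iff)
  qed
  moreover have "set (pairs_at overlap_edges (map c fs)) = set (pairs_at overlap_edges (map c gs))"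
    using edges valid(2) len by (simp add: pairs_at_map)
  moreover have "map c fs \<noteq> rev (map c fs)"
    using not_flip c(1) fsA by (simp add: rev_map inj_on_map_eq_map)
  moreover have "pairs_at doubling_pairs (map c fs) ! i \<noteq> (map c gs ! i, map c gs ! i)" if "i < 6" for i
  proof
    assume a: "pairs_at doubling_pairs (map c fs) ! i = (map c gs ! i, map c gs ! i)"
    have A: "gs ! i \<in> A" using gsA len that by (metis nth_mem)
    have "c (\<beta> (gs ! i) ! 0) = c (gs ! i)" "c (\<beta> (gs ! i) ! 1) = c (gs ! i)"
      using a that len B[OF A] unfolding pairs by auto
    then have "\<beta> (gs ! i) ! 0 = gs ! i" "\<beta> (gs ! i) ! 1 = gs ! i"
      using c(1) A nth_image_in[OF A] by (simp_all add: inj_on_eq_iff)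
    then have "\<beta> (gs ! i) = [gs ! i, gs ! i]" using image_eq[OF A] by simp
    then show False using no_doubled_letter[OF A] by simp
  qed
  ultimately have "\<exists>(t, s)\<in>set table_renamings. renames_to (map c fs) (map c gs) t s"
    using labelling_search[of "map c fs" "map c gs" B] c(2) len fsA gsA pairs by simp
  then obtain t s where ts: "(t, s) \<in> set table_renamings" "renames_to (map c fs) (map c gs) t s"
    by blast
  define f where "f a = s ! c a" for a
  have cA: "c ` A = {0..<length t}" using ts(2) fsA by (simp add: renames_to_def)
  have "bij_betw (\<lambda>n. s ! n) {0..<length t} (table_alphabet t)"
    using ts(2) unfolding renames_to_def table_alphabet_def
    by (intro bij_betw_nth) auto
  moreover have "bij_betw c A {0..<length t}" using c(1) cA by (simp add: bij_betw_def)
  ultimately have "bij_betw f A (table_alphabet t)"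
    using bij_betw_trans unfolding f_def comp_def by fastforce
  moreover have "table_subst t (f a) = map f (\<beta> a)" if a: "a \<in> A" for a
  proof -
    \<comment> \<open>Every letter is a value of the second labelling, and it is for these values
      that \<open>renames_to\<close> prescribes the image.\<close>
    obtain i where i: "i < 6" "a = gs ! i" using a gsA len by (metis in_set_conv_nth)
    have "table_subst t (f a) = [s ! fst (B (c a)), s ! snd (B (c a))]"
      using ts(2) i len pairs by (simp add: renames_to_def list_all_iff f_def table_subst_def)
    also have "\<dots> = map f [\<beta> a ! 0, \<beta> a ! 1]" by (simp add: B[OF a] f_def)
    also have "\<dots> = map f (\<beta> a)" using image_eq[OF a] by simp
    finally show ?thesis .
  qed
  moreover have "t \<in> set twelve_tables"
  proof -
    have "list_all (\<lambda>(t, s). t \<in> set twelve_tables) table_renamings" by code_simp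
    then show ?thesis using ts(1) by (auto simp: list_all_iff)
  qed
  ultimately show ?thesis unfolding same_up_to_renaming_def by blast
qed

lemma conjugate_in_twelve_tables:
  assumes "topologically_conjugate A (subst_space A \<beta>) {0, 1} thue_morse_space"
  shows "\<exists>t\<in>set twelve_tables. same_up_to_renaming A \<beta> (table_alphabet t) (table_subst t)"
proof -
  obtain \<phi> a w where emb: "embeds (block \<phi> a w)" using embedding_exists[OF assms] by blast
  from renormalized_pair[OF emb] obtain \<phi>\<^sub>1 \<phi>\<^sub>2 where "embeds (block \<phi>\<^sub>1 (- 1) 3)" "embeds (block \<phi>\<^sub>2 (- 1) 3)"
    "\<And>x. x \<in> thue_morse_space \<Longrightarrow> block \<phi>\<^sub>1 (- 1) 3 (bisubst thue_morse x) = bisubst \<beta> (block \<phi>\<^sub>2 (- 1) 3 x)"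
    by blast
  then show ?thesis by (rule renaming_of_pair)
qed

end

section \<open>The twelve tables\<close>

text \<open>For each table: the labels of the words in \<open>tm3\<close> under a conjugacy, whether the
  conjugacy intertwines the substitutions only after complementing, and a letter map (listed on
  the labels 1, 2, ...) with the position of the letter of the three-letter word it recovers.\<close>
definition conjugacy_data :: "(nat list \<times> bool \<times> nat list \<times> nat) list" where
  "conjugacy_data =
    [([1,2,2,1,1,2], False, [0,1], 1),
     ([1,2,2,1,1,2], True, [0,1], 1),
     ([1,2,2,1,1,3], False, [0,1,1], 1),
     ([2,1,1,3,2,1], True, [1,0,0], 1),
     ([1,3,2,4,1,3], False, [1,1,0,0], 2),
     ([1,2,4,3,1,2], True, [1,0,0,1], 2),
     ([2,1,1,3,3,4], True, [1,0,0,1], 1),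
     ([2,3,3,1,1,4], False, [0,0,1,1], 1),
     ([1,4,2,5,1,3], False, [1,1,0,0,0], 2),
     ([2,1,1,3,5,4], True, [1,0,0,1,0], 1),
     ([2,1,3,4,6,5], True, [0,1,1,0,0,1], 2),
     ([2,5,3,6,1,4], False, [1,1,1,0,0,0], 2)]"

definition label_of :: "nat list \<Rightarrow> nat list \<Rightarrow> nat" where
  "label_of fs u = the (map_of (zip tm3 fs) u)"

text \<open>An executable form of the hypotheses of \<open>doubling\<close> and
  \<open>thue_morse_conjugateI\<close>. The exponent 3 witnesses primitivity for all twelve tables,
  and the 2^5 = 32 letters of the fifth power at letter 1 show every required two-letter
  word.\<close>

definition table_check :: "nat list list \<Rightarrow> nat list \<times> bool \<times> nat list \<times> nat \<Rightarrow> bool" where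
  "table_check t = (\<lambda>(fs, b, ps, d).
     let k = length t; \<beta> = table_subst t; \<phi> = label_of fs; s = (if b then flip else id); x = subst_pow \<beta> 5 1 in
     2 \<le> k \<and> distinct t \<and> d < 3 \<and>
     list_all (\<lambda>w. length w = 2 \<and> list_all (\<lambda>a. 1 \<le> a \<and> a \<le> k) w) t \<and>
     list_all (\<lambda>a. let v = subst_pow \<beta> 3 a in list_all (\<lambda>c. c \<in> set v) [1..<Suc k]) [1..<Suc k] \<and>
     list_all (\<lambda>u. 1 \<le> \<phi> u \<and> \<phi> u \<le> k \<and> ps ! (\<phi> u - 1) = u ! d \<and>
       (let v = subst_word thue_morse u in \<beta> (\<phi> (map s u)) = [\<phi> (take 3 (drop 1 v)), \<phi> (take 3 (drop 2 v))])) tm3 \<and>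
     list_all (\<lambda>u. list_ex (\<lambda>m. take 2 (drop m x) = [\<phi> (take 3 u), \<phi> (drop 1 u)]) [0..<32]) tm4)"

lemma all_tables_check: "list_all2 table_check twelve_tables conjugacy_data"
  by code_simp

lemma table_check_doubling:
  assumes "table_check t D"
  shows "doubling (table_alphabet t) (table_subst t)"
proof -
  obtain fs b ps d where D: "D = (fs, b, ps, d)" by (cases D)
  have chk: "2 \<le> length t" "distinct t"
    "\<And>w. w \<in> set t \<Longrightarrow> length w = 2 \<and> set w \<subseteq> {1..length t}"
    "\<And>a. a \<in> {1..length t} \<Longrightarrow> {1..length t} \<subseteq> set (subst_pow (table_subst t) 3 a)"
    using assms unfolding table_check_def D
    by (auto simp: Let_def list_all_iff Ball_def less_Suc_eq_le subset_iff simp del: upt_Suc)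
  have mem: "table_subst t a \<in> set t" if "a \<in> {1..length t}" for a
    using that by (auto simp: table_subst_def)
  have image: "length (table_subst t a) = 2 \<and> set (table_subst t a) \<subseteq> {1..length t}"
    if "a \<in> {1..length t}" for a using chk(3) mem[OF that] by blast
  show ?thesis
  proof (unfold_locales, goal_cases)
    case 1
    show ?case unfolding substitution_def table_alphabet_def lists_eq_set using chk(1) image by simp
  next
    case 2
    show ?case unfolding constant_length_def table_alphabet_def using image by simp
  next
    case 3
    show ?case
      using chk(2) by (auto simp: inj_on_def table_subst_def table_alphabet_def nth_eq_iff_index_eq)
  next
    case 4
    show ?case unfolding primitive_def table_alphabet_def using chk(4) by (intro exI[of _ 3]) auto
  qed
qed

lemma table_check_conjugate:
  assumes "table_check t D"
  shows "topologically_conjugate (table_alphabet t) (subst_space (table_alphabet t) (table_subst t)) {0, 1} thue_morse_space"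
proof -
  interpret doubling "table_alphabet t" "table_subst t" by (rule table_check_doubling[OF assms])
  obtain fs b ps d where D: "D = (fs, b, ps, d)" by (cases D)
  define s where "s = (if b then flip else id)"
  have chk: "1 \<le> length t" "d < 3"
    "\<And>u. u \<in> set tm3 \<Longrightarrow> label_of fs u \<in> {1..length t} \<and> ps ! (label_of fs u - 1) = u ! d \<and>
      table_subst t (label_of fs (map s u)) = [label_of fs (take 3 (drop 1 (subst_word thue_morse u))),
        label_of fs (take 3 (drop 2 (subst_word thue_morse u)))]"
    "\<And>u. u \<in> set tm4 \<Longrightarrow> \<exists>m. take 2 (drop m (subst_pow (table_subst t) 5 1)) = [label_of fs (take 3 u), label_of fs (drop 1 u)]"
    using assms unfolding table_check_def D s_def
    by (auto simp: Let_def list_all_iff list_ex_iff simp del: upt_Suc take_upt)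
  show ?thesis
  proof (rule thue_morse_conjugateI)
    show "s = id \<or> s = flip" by (simp add: s_def)
    show "label_of fs u \<in> table_alphabet t" if "u \<in> set tm3" for u
      using chk(3)[OF that] by (simp add: table_alphabet_def)
    show "[label_of fs (take 3 u), label_of fs (drop 1 u)] \<in> language (table_alphabet t) (table_subst t)" if u: "u \<in> set tm4" for u
    proof -
      have "sublist [label_of fs (take 3 u), label_of fs (drop 1 u)] (subst_pow (table_subst t) 5 1)"
        using chk(4)[OF u] sublist_take_drop by metis
      moreover have "1 \<in> table_alphabet t" using chk(1) by (simp add: table_alphabet_def)
      ultimately show ?thesis unfolding language_def by (auto intro!: bexI[of _ 1] exI[of _ 5])
    qed
    show "table_subst t (label_of fs (map s u)) = [label_of fs (take 3 (drop 1 (subst_word thue_morse u))),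
        label_of fs (take 3 (drop 2 (subst_word thue_morse u)))]" if "u \<in> set tm3" for u
      using chk(3)[OF that] by simp
    show "(\<lambda>a. ps ! (a - 1)) (label_of fs u) = u ! d" if "u \<in> set tm3" for u
      using chk(3)[OF that] by simp
    show "d < 3" by (rule chk(2))
  qed
qed

section \<open>Distinctness of the tables up to renaming\<close>

text \<open>The first three counts separate the tables except for two pairs. The fourth
  distinguishes \<open>twelve_tables ! 5\<close> from \<open>twelve_tables ! 7\<close>, and the
  fifth \<open>twelve_tables ! 10\<close> from \<open>twelve_tables ! 11\<close>. The use of
  \<open>Set.filter\<close> lets the counts be evaluated.\<close>

definition renaming_invariant :: "'a set \<Rightarrow> ('a \<Rightarrow> 'a list) \<Rightarrow> nat list" where
  "renaming_invariant A \<alpha> =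
    [card A, card (Set.filter (\<lambda>a. hd (\<alpha> a) = a) A), card (Set.filter (\<lambda>a. last (\<alpha> a) = a) A),
     card ((\<lambda>a. hd (\<alpha> a)) ` A), card (Set.filter (\<lambda>a. last (\<alpha> (hd (\<alpha> a))) = last (\<alpha> a)) A)]"

lemma renaming_invariant_eq:
  assumes "same_up_to_renaming A \<alpha> B \<beta>" and A: "\<And>a. a \<in> A \<Longrightarrow> \<alpha> a \<noteq> [] \<and> set (\<alpha> a) \<subseteq> A"
  shows "renaming_invariant A \<alpha> = renaming_invariant B \<beta>"
proof -
  obtain f where f: "bij_betw f A B" "\<And>a. a \<in> A \<Longrightarrow> \<beta> (f a) = map f (\<alpha> a)"
    using assms(1) by (auto simp: same_up_to_renaming_def)
  have inj: "inj_on f A" and B: "B = f ` A" using f(1) by (auto simp: bij_betw_def)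
  have hd: "hd (\<alpha> a) \<in> A" "hd (\<beta> (f a)) = f (hd (\<alpha> a))" and
    last: "last (\<alpha> a) \<in> A" "last (\<beta> (f a)) = f (last (\<alpha> a))" if "a \<in> A" for a
    using A[OF that] f(2)[OF that] by (auto simp: hd_map last_map)
  have card_filter: "card (Set.filter P A) = card (Set.filter Q B)" if "\<And>a. a \<in> A \<Longrightarrow> Q (f a) = P a" for P Q
  proof (rule bij_betw_same_card[of f])
    show "bij_betw f (Set.filter P A) (Set.filter Q B)"
      unfolding B using that inj by (force simp: bij_betw_def inj_on_def)
  qed
  have "(\<lambda>b. hd (\<beta> b)) ` B = f ` (\<lambda>a. hd (\<alpha> a)) ` A"
    unfolding B image_image using hd by (intro image_cong) auto
  moreover have "inj_on f ((\<lambda>a. hd (\<alpha> a)) ` A)"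
    by (rule inj_on_subset[OF inj]) (use hd in auto)
  ultimately have "card ((\<lambda>a. hd (\<alpha> a)) ` A) = card ((\<lambda>b. hd (\<beta> b)) ` B)"
    by (simp add: card_image)
  moreover have "card A = card B" using f(1) by (rule bij_betw_same_card)
  moreover have "card (Set.filter (\<lambda>a. hd (\<alpha> a) = a) A) = card (Set.filter (\<lambda>a. hd (\<beta> a) = a) B)"
    by (rule card_filter) (simp add: hd inj_on_eq_iff[OF inj])
  moreover have "card (Set.filter (\<lambda>a. last (\<alpha> a) = a) A) = card (Set.filter (\<lambda>a. last (\<beta> a) = a) B)"
    by (rule card_filter) (simp add: last inj_on_eq_iff[OF inj])
  moreover have "card (Set.filter (\<lambda>a. last (\<alpha> (hd (\<alpha> a))) = last (\<alpha> a)) A)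
      = card (Set.filter (\<lambda>a. last (\<beta> (hd (\<beta> a))) = last (\<beta> a)) B)"
    by (rule card_filter) (simp add: hd last inj_on_eq_iff[OF inj])
  ultimately show ?thesis
    unfolding renaming_invariant_def by (simp only:)
qed

lemma invariants_distinct:
  "distinct (map (\<lambda>t. renaming_invariant (table_alphabet t) (table_subst t)) twelve_tables)"
  by code_simp

theorem mainTheorem6:
  shows "length twelve_tables = 12 \<and>
    (\<forall>t\<in>set twelve_tables.
       substitution (table_alphabet t) (table_subst t) \<and>
       constant_length (table_alphabet t) (table_subst t) 2 \<and>
       inj_on (table_subst t) (table_alphabet t) \<and>
       primitive (table_alphabet t) (table_subst t) \<and>
       topologically_conjugate
         (table_alphabet t) (subst_space (table_alphabet t) (table_subst t))
         {0, 1} thue_morse_space) \<and>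
    (\<forall>i<12. \<forall>j<12. i \<noteq> j \<longrightarrow>
       \<not> same_up_to_renaming
           (table_alphabet (twelve_tables ! i)) (table_subst (twelve_tables ! i))
           (table_alphabet (twelve_tables ! j)) (table_subst (twelve_tables ! j))) \<and>
    (\<forall>(A :: 'a set) \<beta>.
       substitution A \<beta> \<and> constant_length A \<beta> 2 \<and> inj_on \<beta> A \<and> primitive A \<beta> \<and>
       topologically_conjugate A (subst_space A \<beta>) {0, 1} thue_morse_space \<longrightarrow>
       (\<exists>t\<in>set twelve_tables.
          same_up_to_renaming A \<beta> (table_alphabet t) (table_subst t)))"
proof (intro conjI ballI allI impI)
  show len: "length twelve_tables = 12" by (simp add: twelve_tables_def)
  have check: "\<exists>D. table_check t D" if "t \<in> set twelve_tables" for t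
    using all_tables_check that by (metis in_set_conv_nth list_all2_nthD)
  fix t assume t: "t \<in> set twelve_tables"
  then obtain D where D: "table_check t D" using check by blast
  interpret doubling "table_alphabet t" "table_subst t" by (rule table_check_doubling[OF D])
  show "substitution (table_alphabet t) (table_subst t)" by (rule substitution)
  show "constant_length (table_alphabet t) (table_subst t) 2" by (rule constant_length)
  show "inj_on (table_subst t) (table_alphabet t)" by (rule inj)
  show "primitive (table_alphabet t) (table_subst t)" by (rule primitive)
  show "topologically_conjugate (table_alphabet t) (subst_space (table_alphabet t) (table_subst t))
      {0, 1} thue_morse_space"
    by (rule table_check_conjugate[OF D])
next
  fix i j :: nat assume ij: "i < 12" "j < 12" "i \<noteq> j"
  have len: "length twelve_tables = 12" by (simp add: twelve_tables_def)
  show "\<not> same_up_to_renaming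
      (table_alphabet (twelve_tables ! i)) (table_subst (twelve_tables ! i))
      (table_alphabet (twelve_tables ! j)) (table_subst (twelve_tables ! j))"
  proof
    assume "same_up_to_renaming
      (table_alphabet (twelve_tables ! i)) (table_subst (twelve_tables ! i))
      (table_alphabet (twelve_tables ! j)) (table_subst (twelve_tables ! j))"
    moreover obtain D where "table_check (twelve_tables ! i) D"
      using all_tables_check ij(1) len by (metis list_all2_nthD)
    then interpret doubling "table_alphabet (twelve_tables ! i)" "table_subst (twelve_tables ! i)"
      by (rule table_check_doubling)
    have "table_subst (twelve_tables ! i) a \<noteq> [] \<and>
        set (table_subst (twelve_tables ! i) a) \<subseteq> table_alphabet (twelve_tables ! i)"
      if "a \<in> table_alphabet (twelve_tables ! i)" for a
      using length_image[OF that] set_image[OF that] by auto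
    ultimately have "renaming_invariant (table_alphabet (twelve_tables ! i)) (table_subst (twelve_tables ! i))
        = renaming_invariant (table_alphabet (twelve_tables ! j)) (table_subst (twelve_tables ! j))"
      by (rule renaming_invariant_eq)
    then show False
      using nth_eq_iff_index_eq[OF invariants_distinct, of i j] ij len by simp
  qed
next
  fix A :: "'a set" and \<beta>
  assume "substitution A \<beta> \<and> constant_length A \<beta> 2 \<and> inj_on \<beta> A \<and> primitive A \<beta> \<and>
       topologically_conjugate A (subst_space A \<beta>) {0, 1} thue_morse_space"
  then interpret doubling A \<beta> by unfold_locales auto
  show "\<exists>t\<in>set twelve_tables. same_up_to_renaming A \<beta> (table_alphabet t) (table_subst t)"
    by (rule conjugate_in_twelve_tables) (use \<open>_ \<and> _\<close> in blast)
qed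

end
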